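(* Let $n\ge2$ be an integer, let $1<p\le n$, and let $X=B(0,1)\setminus\{0\}\subset\mathbf R^n$, endowed with the Euclidean metric and the Lebesgue measure $m_n$. Then the Lipschitz functions are not dense in $N^{1,L^{p,\infty}}(X,m_n)$: there is a function $u\in N^{1,L^{p,\infty}}(X,m_n)$ which is not the limit in $N^{1,L^{p,\infty}}(X,m_n)$ of any sequence of Lipschitz functions on $X$ belonging to $N^{1,L^{p,\infty}}(X,m_n)$.
   Context: $B(0,1)$ is the open unit ball. For a measurable $f:X\to[-\infty,\infty]$, $\|f\|_{L^{p,\infty}(X,m_n)}=\sup_{t>0}t\,m_n(\{x\in X:|f(x)|>t\})^{1/p}$, and $L^{p,\infty}(X,m_n)$ is the set of measurable $f$ for which this is finite. Modulus: a curve in $X$ is rectifiable if it has finite length; a rectifiable curve $\gamma$ is parametrized by arc length on $[0,\ell(\gamma)]$, and $\int_\gamma\rho=\int_0^{\ell(\gamma)}\rho(\gamma(s))\,ds$ for Borel $\rho\ge0$. $\Gamma_{\rm rect}$ is the family of all nonconstant rectifiable curves in $X$. For $\Gamma\subset\Gamma_{\rm rect}$, $F(\Gamma)$ is the family of Borel $\rho:X\to[0,\infty]$ with $\int_\gamma\rho\ge1$ for every $\gamma\in\Gamma$, and $\mathrm{Mod}_{p,\infty}(\Gamma)=\inf_{\rho\in F(\Gamma)}\|\rho\|_{L^{p,\infty}(X,m_n)}^p$. A property holds for $p,\infty$-almost every curve if it holds on all curves of $\Gamma_{\rm rect}$ outside a family of zero $\mathrm{Mod}_{p,\infty}$. Weak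 upper gradient: a Borel $g:X\to[0,\infty]$ is a $p,\infty$-weak upper gradient of a Borel $u:X\to[-\infty,\infty]$ if for $p,\infty$-almost every $\gamma\in\Gamma_{\rm rect}$ one has $|u(\gamma(0))-u(\gamma(\ell(\gamma)))|\le\int_\gamma g$ whenever both $u(\gamma(0)),u(\gamma(\ell(\gamma)))$ are finite, and $\int_\gamma g=\infty$ otherwise. Newtonian space: $\widetilde N^{1,L^{p,\infty}}(X,m_n)$ is the space of Borel functions $u\in L^{p,\infty}(X,m_n)$ having a $p,\infty$-weak upper gradient in $L^{p,\infty}(X,m_n)$, with $\|u\|_{N^{1,L^{p,\infty}}}=(\|u\|_{L^{p,\infty}}^{p}+\inf_g\|g\|_{L^{p,\infty}}^{p})^{1/p}$, the infimum over all $p,\infty$-weak upper gradients $g\in L^{p,\infty}(X,m_n)$ of $u$. $N^{1,L^{p,\infty}}(X,m_n)$ is the quotient by $u\sim v\iff\|u-v\|_{N^{1,L^{p,\infty}}}=0$; convergence and density are with respect to $\|\cdot\|_{N^{1,L^{p,\infty}}}$. *)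

theory Defs
  imports "HOL-Analysis.Analysis"
begin

text \<open>Only meant for positive exponents.\<close>

definition ennreal_powr :: "ennreal \<Rightarrow> real \<Rightarrow> ennreal" where
  "ennreal_powr x a = (if x = \<infinity> then \<infinity> else ennreal (enn2real x powr a))"

section \<open>Weak Lebesgue spaces\<close>

definition weak_norm :: "real \<Rightarrow> 'a measure \<Rightarrow> ('a \<Rightarrow> ereal) \<Rightarrow> ennreal" where
  "weak_norm p M f =
     (SUP t\<in>{0<..}. ennreal t * ennreal_powr (emeasure M {x \<in> space M. \<bar>f x\<bar> > ereal t}) (1 / p))"

definition weak_Lp :: "real \<Rightarrow> 'a measure \<Rightarrow> ('a \<Rightarrow> ereal) set" where
  "weak_Lp p M = {f \<in> borel_measurable M. weak_norm p M f < \<infinity>}"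

section \<open>Rectifiable curves\<close>

definition curve_length :: "(real \<Rightarrow> 'a::metric_space) \<Rightarrow> real \<Rightarrow> real \<Rightarrow> ennreal" where
  "curve_length \<gamma> a b =
     (SUP (n, t) \<in> {(n::nat, t::nat \<Rightarrow> real). t 0 = a \<and> t n = b \<and> (\<forall>i<n. t i \<le> t (Suc i))}.
        \<Sum>i<n. ennreal (dist (\<gamma> (t i)) (\<gamma> (t (Suc i)))))"

text \<open>
  As in the library notion of \<^const>\<open>path\<close>, curves are given on the interval from 0 to 1, and values
  outside of it are irrelevant.
\<close>

definition rect_curves :: "'a::metric_space set \<Rightarrow> (real \<Rightarrow> 'a) set" where
  "rect_curves X = {\<gamma>. path \<gamma> \<and> path_image \<gamma> \<subseteq> X \<and> \<not> \<gamma> constant_on {0..1} \<and>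
                        curve_length \<gamma> 0 1 < \<infinity>}"

text \<open>
  The point of \<open>\<gamma>\<close> at arc length \<open>s\<close>. For a curve of finite length and \<open>s\<close> between 0 and the total
  length such a \<open>t\<close> exists since the length function is continuous, and any two choices give the same
  point since the curve is constant between them.
\<close>

definition arclen_param :: "(real \<Rightarrow> 'a::metric_space) \<Rightarrow> real \<Rightarrow> 'a" where
  "arclen_param \<gamma> s = \<gamma> (SOME t. t \<in> {0..1} \<and> curve_length \<gamma> 0 t = ennreal s)"

definition curve_integral :: "(real \<Rightarrow> 'a::metric_space) \<Rightarrow> ('a \<Rightarrow> ennreal) \<Rightarrow> ennreal" where
  "curve_integral \<gamma> \<rho> =
     (\<integral>\<^sup>+ s\<in>{0..enn2real (curve_length \<gamma> 0 1)}. \<rho> (arclen_param \<gamma> s) \<partial>lborel)"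

section \<open>Modulus\<close>

text \<open>
  Functions on \<open>X\<close> are total functions whose values outside \<open>X\<close> are irrelevant; Borel functions on
  \<open>X\<close> are those measurable on \<^term>\<open>restrict_space borel X\<close>.
\<close>

definition admissible :: "'a::euclidean_space set \<Rightarrow> (real \<Rightarrow> 'a) set \<Rightarrow> ('a \<Rightarrow> ennreal) set" where
  "admissible X \<Gamma> =
     {\<rho> \<in> borel_measurable (restrict_space borel X). \<forall>\<gamma>\<in>\<Gamma>. curve_integral \<gamma> \<rho> \<ge> 1}"

definition modulus :: "real \<Rightarrow> 'a::euclidean_space set \<Rightarrow> (real \<Rightarrow> 'a) set \<Rightarrow> ennreal" where
  "modulus p X \<Gamma> =
     (INF \<rho>\<in>admissible X \<Gamma>. ennreal_powr (weak_norm p (lebesgue_on X) (enn2ereal \<circ> \<rho>)) p)"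

definition almost_every_curve ::
    "real \<Rightarrow> 'a::euclidean_space set \<Rightarrow> ((real \<Rightarrow> 'a) \<Rightarrow> bool) \<Rightarrow> bool" where
  "almost_every_curve p X P \<longleftrightarrow>
     (\<exists>\<Gamma>\<subseteq>rect_curves X. modulus p X \<Gamma> = 0 \<and> (\<forall>\<gamma>\<in>rect_curves X - \<Gamma>. P \<gamma>))"

section \<open>Newtonian spaces\<close>

definition weak_upper_gradient ::
    "real \<Rightarrow> 'a::euclidean_space set \<Rightarrow> ('a \<Rightarrow> ereal) \<Rightarrow> ('a \<Rightarrow> ennreal) \<Rightarrow> bool" where
  "weak_upper_gradient p X u g \<longleftrightarrow>
     g \<in> borel_measurable (restrict_space borel X) \<and>
     almost_every_curve p X (\<lambda>\<gamma>.
       if \<bar>u (pathstart \<gamma>)\<bar> \<noteq> \<infinity> \<and> \<bar>u (pathfinish \<gamma>)\<bar> \<noteq> \<infinity>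
       then e2ennreal \<bar>u (pathstart \<gamma>) - u (pathfinish \<gamma>)\<bar> \<le> curve_integral \<gamma> g
       else curve_integral \<gamma> g = \<infinity>)"

definition Lp_weak_upper_gradients ::
    "real \<Rightarrow> 'a::euclidean_space set \<Rightarrow> ('a \<Rightarrow> ereal) \<Rightarrow> ('a \<Rightarrow> ennreal) set" where
  "Lp_weak_upper_gradients p X u =
     {g. weak_upper_gradient p X u g \<and> enn2ereal \<circ> g \<in> weak_Lp p (lebesgue_on X)}"

definition pre_newtonian :: "real \<Rightarrow> 'a::euclidean_space set \<Rightarrow> ('a \<Rightarrow> ereal) set" where
  "pre_newtonian p X =
     {u \<in> borel_measurable (restrict_space borel X).
        u \<in> weak_Lp p (lebesgue_on X) \<and> Lp_weak_upper_gradients p X u \<noteq> {}}"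

definition newtonian_norm :: "real \<Rightarrow> 'a::euclidean_space set \<Rightarrow> ('a \<Rightarrow> ereal) \<Rightarrow> ennreal" where
  "newtonian_norm p X u =
     ennreal_powr
       (ennreal_powr (weak_norm p (lebesgue_on X) u) p +
        (INF g\<in>Lp_weak_upper_gradients p X u.
           ennreal_powr (weak_norm p (lebesgue_on X) (enn2ereal \<circ> g)) p))
       (1 / p)"

text \<open>
  In \<open>u - v\<close> the points where both functions take the same infinite value get the value \<open>\<infinity>\<close>
  (convention of \<^typ>\<open>ereal\<close>). A function in \<open>pre_newtonian\<close> is infinite only on a null set that almost every
  curve avoids, so this choice does not affect the norm.
\<close>

definition newtonian_rel ::
    "real \<Rightarrow> 'a::euclidean_space set \<Rightarrow> (('a \<Rightarrow> ereal) \<times> ('a \<Rightarrow> ereal)) set" where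
  "newtonian_rel p X =
     {(u, v). u \<in> pre_newtonian p X \<and> v \<in> pre_newtonian p X \<and>
              newtonian_norm p X (\<lambda>x. u x - v x) = 0}"

definition newtonian :: "real \<Rightarrow> 'a::euclidean_space set \<Rightarrow> ('a \<Rightarrow> ereal) set set" where
  "newtonian p X = pre_newtonian p X // newtonian_rel p X"

definition newtonian_class ::
    "real \<Rightarrow> 'a::euclidean_space set \<Rightarrow> ('a \<Rightarrow> ereal) \<Rightarrow> ('a \<Rightarrow> ereal) set" where
  "newtonian_class p X u = newtonian_rel p X `` {u}"

text \<open>
  The norm of the difference of two classes. It does not depend on the representatives; the infimum
  merely avoids a choice.
\<close>

definition newtonian_dist ::
    "real \<Rightarrow> 'a::euclidean_space set \<Rightarrow> ('a \<Rightarrow> ereal) set \<Rightarrow> ('a \<Rightarrow> ereal) set \<Rightarrow> ennreal" where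
  "newtonian_dist p X U V = (INF u\<in>U. INF v\<in>V. newtonian_norm p X (\<lambda>x. u x - v x))"

end

theory Submission
  imports Defs
begin

text \<open>
  Let \<open>b = n / p\<close>. The witness is the radial function \<open>u x = F (norm x)\<close> with \<open>F 1 = 0\<close> and
  \<open>F' s = - (s powr - b)\<close>: a logarithm if \<open>p = n\<close>, a negative power of the norm plus a constant if
  \<open>p < n\<close>. Its gradient has length \<open>norm x powr - b\<close>. This function lies in weak \<open>L\<^sup>p\<close>, but its norm does
  not become small on small balls around 0. Subtracting a Lipschitz function changes the gradient only by a
  bounded amount, which is negligible near 0, so no Lipschitz function comes close to \<open>u\<close>.

  That \<open>u\<close> belongs to the space is \<open>radial_singularity_in_pre_newtonian\<close>. Its essential part is that the
  gradient is an upper gradient along all rectifiable curves (\<open>radial_upper_gradient\<close>), which rests on the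
  arc length parametrization being 1-Lipschitz (\<open>arclen_param_lipschitz\<close>).

  The lower bound for the distance does not differentiate anything. For \<open>x\<close> in a small ball of radius \<open>r\<close>
  the segment from \<open>x\<close> to \<open>2 *\<^sub>R x\<close> is a curve along which \<open>u\<close> minus a Lipschitz function changes by at least
  a constant times \<open>r powr (1 - b)\<close> (\<open>radial_singularity_oscillation\<close>). So the curve integral of a weak upper
  gradient over such a segment is at least that large, unless the segment is exceptional. Averaging over all \<open>x\<close>
  in the ball turns the curve integrals into a volume integral (\<open>nn_integral_dilation_integral_le\<close>), which the
  weak norm controls (\<open>nn_integral_le_weak_norm\<close>). The power of \<open>r\<close> is the same on both sides, so the
  weak norm of the upper gradient is bounded below by a constant that depends on \<open>n\<close> and \<open>p\<close> alone
  (\<open>radial_singularity_not_near_lipschitz\<close>).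
\<close>

section \<open>Weak norms and integrals over sets of finite measure\<close>

lemma ennreal_powr_lessD:
  assumes "ennreal_powr x a < ennreal e" "0 < a" "0 < e"
  shows "x < ennreal (e powr (1 / a))"
proof (cases x)
  case (real y)
  then have "y powr a < e" using assms by (simp add: ennreal_powr_def ennreal_less_iff)
  then have "(y powr a) powr (1 / a) < e powr (1 / a)"
    using assms by (intro powr_less_mono2) auto
  then show ?thesis using real assms by (simp add: powr_powr ennreal_less_iff)
qed (use assms in \<open>simp add: ennreal_powr_def\<close>)

lemma ennreal_powr_leD:
  assumes "ennreal_powr x a \<le> ennreal e" "0 < a" "0 \<le> e"
  shows "x \<le> ennreal (e powr (1 / a))"
proof (cases x)
  case (real y)
  then have "y powr a \<le> e" using assms by (simp add: ennreal_powr_def)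
  then have "(y powr a) powr (1 / a) \<le> e powr (1 / a)"
    using assms by (intro powr_mono2) auto
  then show ?thesis using real assms by (simp add: powr_powr ennreal_leI)
qed (use assms in \<open>simp add: ennreal_powr_def top_unique\<close>)

lemma ennreal_powr_mono:
  assumes "x \<le> y" "0 \<le> a" shows "ennreal_powr x a \<le> ennreal_powr y a"
  using assms by (cases x; cases y)
    (auto simp: ennreal_powr_def top_unique intro!: ennreal_leI powr_mono2)

lemma weak_norm_tail:
  assumes norm: "weak_norm p M f \<le> ennreal N" and pos: "0 < t" "0 < p" "0 \<le> N"
  shows "emeasure M {x \<in> space M. \<bar>f x\<bar> > ereal t} \<le> ennreal ((N / t) powr p)"
proof -
  let ?m = "ennreal_powr (emeasure M {x \<in> space M. \<bar>f x\<bar> > ereal t}) (1 / p)"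
  have "ennreal t * ?m \<le> weak_norm p M f"
    unfolding weak_norm_def by (rule SUP_upper) (use pos in auto)
  also note norm
  finally have le: "ennreal t * ?m \<le> ennreal N" .
  have "?m \<le> ennreal (N / t)"
  proof (cases ?m)
    case (real y)
    then show ?thesis using le pos by (simp add: ennreal_mult[symmetric] ennreal_leI field_simps)
  qed (use le pos in \<open>simp add: ennreal_mult_top top_unique\<close>)
  then show ?thesis
    using ennreal_powr_leD[of _ "1 / p" "N / t"] pos by simp
qed

text \<open>
  For \<open>a = 0\<close> this is the layer cake formula. The truncation at \<open>a\<close> keeps the singularity at 0 of the
  weak-type tail \<open>t powr - p\<close> out of the integral.
\<close>
lemma ennreal_le_layer_cake:
  fixes y :: ennreal
  assumes "0 \<le> a"
  shows "y \<le> ennreal a + (\<integral>\<^sup>+ t. indicator {a..} t * (if ennreal t < y then 1 else 0) \<partial>lborel)"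
proof (cases y)
  case (real z)
  have "(\<integral>\<^sup>+ t. indicator {a..} t * (if ennreal t < y then 1 else 0) \<partial>lborel) = (\<integral>\<^sup>+ t. indicator {a..<z} t \<partial>lborel)"
    by (intro nn_integral_cong) (use real assms in \<open>auto simp: indicator_def ennreal_less_iff\<close>)
  also have "\<dots> = ennreal (max 0 (z - a))" by (cases "a \<le> z") (simp_all add: max_def)
  finally show ?thesis using real assms by (auto simp flip: ennreal_plus intro!: ennreal_leI)
next
  case top
  have "(\<integral>\<^sup>+ t. indicator {a..} t * (if ennreal t < y then 1 else 0) \<partial>lborel) = (\<integral>\<^sup>+ t. indicator {a..} t \<partial>lborel)"
    by (intro nn_integral_cong) (use top in \<open>auto simp: indicator_def\<close>)
  also have "\<dots> = emeasure lborel {a..}" by simp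
  also have "\<dots> = top"
  proof (rule ccontr)
    assume "emeasure lborel {a..} \<noteq> top"
    then obtain z where z: "emeasure lborel {a..} = ennreal z" "0 \<le> z" by (cases "emeasure lborel {a..}") auto
    moreover have "emeasure lborel {a..a + (z + 1)} \<le> emeasure lborel {a..}"
      by (rule emeasure_mono) auto
    ultimately show False by simp
  qed
  finally show ?thesis by simp
qed

text \<open>
  Weak \<open>L\<^sup>p\<close> embeds locally into \<open>L\<^sup>1\<close> because \<open>p > 1\<close>: levels below \<open>a\<close> are paid for by the measure
  of \<open>B\<close>, and the tail bound is integrable over the levels above \<open>a\<close>. The level \<open>a\<close> is left
  free so that it can be adapted to the size of \<open>B\<close>.
\<close>
lemma nn_integral_le_weak_norm:
  assumes M: "finite_measure M" and f[measurable]: "f \<in> borel_measurable M" and B[measurable]: "B \<in> sets M"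
    and norm: "weak_norm p M (enn2ereal \<circ> f) \<le> ennreal N"
    and p: "1 < p" and a: "0 < a" and N: "0 \<le> N"
  shows "(\<integral>\<^sup>+x\<in>B. f x \<partial>M) \<le> ennreal a * emeasure M B + ennreal (N powr p * a powr (1 - p) / (p - 1))"
proof -
  interpret finite_measure M by fact
  interpret P: pair_sigma_finite M lborel ..
  define c where "c = N powr p / (p - 1)"
  define k where "k = (\<lambda>x t. indicator {a..} t * (if ennreal t < f x then 1 else 0 :: ennreal))"
  have [measurable]: "(\<lambda>(x, t). k x t) \<in> borel_measurable (M \<Otimes>\<^sub>M lborel)"
    unfolding k_def by measurable
  have "(\<integral>\<^sup>+x\<in>B. f x \<partial>M) \<le> (\<integral>\<^sup>+x. ennreal a * indicator B x + (\<integral>\<^sup>+t. k x t \<partial>lborel) \<partial>M)"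
  proof (rule nn_integral_mono)
    fix x
    show "f x * indicator B x \<le> ennreal a * indicator B x + (\<integral>\<^sup>+t. k x t \<partial>lborel)"
      using ennreal_le_layer_cake[of a "f x"] a by (auto simp: indicator_def[of B] k_def)
  qed
  also have "\<dots> = ennreal a * emeasure M B + (\<integral>\<^sup>+x. (\<integral>\<^sup>+t. k x t \<partial>lborel) \<partial>M)"
    by (subst nn_integral_add) (auto simp: nn_integral_cmult_indicator)
  also have "(\<integral>\<^sup>+x. (\<integral>\<^sup>+t. k x t \<partial>lborel) \<partial>M) = (\<integral>\<^sup>+t. (\<integral>\<^sup>+x. k x t \<partial>M) \<partial>lborel)"
    by (rule P.Fubini'[symmetric]) measurable
  also have "\<dots> \<le> (\<integral>\<^sup>+t. ennreal (N powr p * t powr - p) * indicator {a..} t \<partial>lborel)"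
  proof (rule nn_integral_mono)
    fix t
    show "(\<integral>\<^sup>+x. k x t \<partial>M) \<le> ennreal (N powr p * t powr - p) * indicator {a..} t"
    proof (cases "a \<le> t")
      case True
      have "(\<integral>\<^sup>+x. k x t \<partial>M) = (\<integral>\<^sup>+x. indicator {x \<in> space M. ennreal t < f x} x \<partial>M)"
        by (intro nn_integral_cong) (use True in \<open>auto simp: k_def\<close>)
      also have "\<dots> = emeasure M {x \<in> space M. ennreal t < f x}" by simp
      also have "{x \<in> space M. ennreal t < f x} = {x \<in> space M. \<bar>(enn2ereal \<circ> f) x\<bar> > ereal t}"
        using True a by (auto simp: less_ennreal.rep_eq enn2ereal_ennreal)
      also have "emeasure M \<dots> \<le> ennreal ((N / t) powr p)"
        by (rule weak_norm_tail[OF norm]) (use True a p N in auto)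
      finally show ?thesis using True a N by (simp add: powr_divide powr_minus_divide)
    qed (simp add: k_def)
  qed
  also have "\<dots> = ennreal (0 - - (c * a powr (1 - p)))"
  proof (rule nn_integral_FTC_atLeast)
    fix x assume "a \<le> x"
    then have "((\<lambda>x. - (c * x powr (1 - p))) has_real_derivative - (c * ((1 - p) * x powr (1 - p - 1)))) (at x)"
      using a by (auto intro!: derivative_eq_intros)
    also have "- (c * ((1 - p) * x powr (1 - p - 1))) = N powr p * x powr - p"
      using p by (simp add: c_def field_simps)
    finally show "((\<lambda>x. - (c * x powr (1 - p))) has_real_derivative N powr p * x powr - p) (at x)" .
  next
    have "((\<lambda>x. - (c * x powr (1 - p))) \<longlongrightarrow> - (c * 0)) at_top"
      by (intro tendsto_intros tendsto_neg_powr) (use p in \<open>auto simp: filterlim_ident\<close>)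
    then show "((\<lambda>x. - (c * x powr (1 - p))) \<longlongrightarrow> 0) at_top" by simp
  qed auto
  finally show ?thesis by (simp add: add_left_mono c_def)
qed

section \<open>Length of curves\<close>

lemma subdivision_bounds:
  fixes t :: "nat \<Rightarrow> real"
  assumes "t 0 = a" "t n = b" "\<forall>i<n. t i \<le> t (Suc i)" "i \<le> n"
  shows "a \<le> t i" "t i \<le> b"
proof -
  have "i \<le> n \<Longrightarrow> a \<le> t i" for i
    using assms by (induction i) (auto intro: order_trans)
  then show "a \<le> t i" using assms by blast
  have "n - k \<le> n \<Longrightarrow> k \<le> n \<Longrightarrow> t (n - k) \<le> b" for k
  proof (induction k)
    case (Suc k)
    then have "t (n - Suc k) \<le> t (Suc (n - Suc k))"
      using assms by auto
    with Suc show ?case by (simp add: Suc_diff_Suc)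
  qed (use assms in auto)
  from this[of "n - i"] show "t i \<le> b" using assms by auto
qed

lemma sum_le_curve_length:
  assumes "t 0 = a" "t n = b" "\<And>i. i < n \<Longrightarrow> t i \<le> t (Suc i)"
  shows "(\<Sum>i<n. ennreal (dist (\<gamma> (t i)) (\<gamma> (t (Suc i))))) \<le> curve_length \<gamma> a b"
proof -
  have "(n, t) \<in> {(n, t). t 0 = a \<and> t n = b \<and> (\<forall>i<n. t i \<le> t (Suc i))}"
    using assms by auto
  from SUP_upper[OF this, of "\<lambda>(n, t). \<Sum>i<n. ennreal (dist (\<gamma> (t i)) (\<gamma> (t (Suc i))))"]
  show ?thesis unfolding curve_length_def by simp
qed

lemma curve_length_leI:
  assumes "\<And>n t. t 0 = a \<Longrightarrow> t n = b \<Longrightarrow> \<forall>i<n. t i \<le> t (Suc i) \<Longrightarrow>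
     (\<Sum>i<n. ennreal (dist (\<gamma> (t i)) (\<gamma> (t (Suc i))))) \<le> C"
  shows "curve_length \<gamma> a b \<le> C"
  unfolding curve_length_def by (rule SUP_least) (use assms in auto)

lemma less_curve_lengthE:
  assumes "c < curve_length \<gamma> a b"
  obtains n t where "t 0 = a" "t n = b" "\<forall>i<n. t i \<le> t (Suc i)"
    "c < (\<Sum>i<n. ennreal (dist (\<gamma> (t i)) (\<gamma> (t (Suc i)))))"
  using assms unfolding curve_length_def less_SUP_iff by auto

lemma dist_le_curve_length:
  assumes "a \<le> b"
  shows "ennreal (dist (\<gamma> a) (\<gamma> b)) \<le> curve_length \<gamma> a b"
  using sum_le_curve_length[of "\<lambda>i. if i = 0 then a else b" a 1 b \<gamma>] assms by simp

text \<open>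
  For the upper bound a subdivision of the whole interval is clipped at \<open>b\<close> from both sides; clipping at a
  point is the same as inserting it.
\<close>
lemma curve_length_add:
  assumes "a \<le> b" "b \<le> c"
  shows "curve_length \<gamma> a c = curve_length \<gamma> a b + curve_length \<gamma> b c"
proof (rule antisym)
  show "curve_length \<gamma> a c \<le> curve_length \<gamma> a b + curve_length \<gamma> b c"
  proof (rule curve_length_leI)
    fix n and t :: "nat \<Rightarrow> real"
    assume t: "t 0 = a" "t n = c" "\<forall>i<n. t i \<le> t (Suc i)"
    let ?d = "\<lambda>x y. ennreal (dist (\<gamma> x) (\<gamma> y))"
    have "(\<Sum>i<n. ?d (t i) (t (Suc i))) \<le>
       (\<Sum>i<n. ?d (min (t i) b) (min (t (Suc i)) b) + ?d (max (t i) b) (max (t (Suc i)) b))"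
    proof (rule sum_mono)
      fix i assume "i \<in> {..<n}"
      then have "t i \<le> t (Suc i)" using t by auto
      then consider "t (Suc i) \<le> b" | "b \<le> t i" | "t i \<le> b" "b \<le> t (Suc i)" by linarith
      then show "?d (t i) (t (Suc i)) \<le>
         ?d (min (t i) b) (min (t (Suc i)) b) + ?d (max (t i) b) (max (t (Suc i)) b)"
      proof cases
        case 3
        then show ?thesis
          by (simp add: ennreal_plus[symmetric] dist_triangle del: ennreal_plus)
      qed (use \<open>t i \<le> t (Suc i)\<close> in \<open>simp_all add: min_def max_def\<close>)
    qed
    also have "\<dots> = (\<Sum>i<n. ?d (min (t i) b) (min (t (Suc i)) b)) +
        (\<Sum>i<n. ?d (max (t i) b) (max (t (Suc i)) b))"
      by (rule sum.distrib)
    also have "\<dots> \<le> curve_length \<gamma> a b + curve_length \<gamma> b c"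
      by (intro add_mono sum_le_curve_length[of "\<lambda>i. min (t i) b"]
          sum_le_curve_length[of "\<lambda>i. max (t i) b"])
        (use t assms in \<open>auto simp: min_def max_def\<close>)
    finally show "(\<Sum>i<n. ?d (t i) (t (Suc i))) \<le> curve_length \<gamma> a b + curve_length \<gamma> b c" .
  qed
next
  let ?d = "\<lambda>x y. ennreal (dist (\<gamma> x) (\<gamma> y))"
  have concat: "(\<Sum>i<n. ?d (t i) (t (Suc i))) + (\<Sum>i<m. ?d (s i) (s (Suc i))) \<le> curve_length \<gamma> a c"
    if t: "t 0 = a" "t n = b" "\<forall>i<n. t i \<le> t (Suc i)"
      and s: "s 0 = b" "s m = c" "\<forall>i<m. s i \<le> s (Suc i)" for n m s t
  proof -
    define w where "w i = (if i \<le> n then t i else s (i - n))" for i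
    have w: "w (n + i) = s i" for i using t s by (cases i) (auto simp: w_def)
    have "(\<Sum>i<n. ?d (t i) (t (Suc i))) = (\<Sum>i<n. ?d (w i) (w (Suc i)))"
      by (auto simp: w_def)
    moreover have "(\<Sum>i<m. ?d (s i) (s (Suc i))) = (\<Sum>i=n..<n+m. ?d (w i) (w (Suc i)))"
      using sum.shift_bounds_nat_ivl[of "\<lambda>i. ?d (w i) (w (Suc i))" 0 n m]
      by (simp add: w add.commute[of _ n] flip: add_Suc_right atLeast0LessThan)
    moreover have "(\<Sum>i<n. ?d (w i) (w (Suc i))) + (\<Sum>i=n..<n+m. ?d (w i) (w (Suc i)))
        = (\<Sum>i<n+m. ?d (w i) (w (Suc i)))"
      using sum.atLeastLessThan_concat[of 0 n "n+m" "\<lambda>i. ?d (w i) (w (Suc i))"]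
      by (simp flip: atLeast0LessThan)
    moreover have "\<dots> \<le> curve_length \<gamma> a c"
    proof (rule sum_le_curve_length)
      fix i assume "i < n + m"
      show "w i \<le> w (Suc i)"
      proof (cases "i < n")
        case True then show ?thesis using t by (auto simp: w_def)
      next
        case False
        then have "w i = s (i - n)" "w (Suc i) = s (Suc (i - n))"
          using w[of "i - n"] w[of "Suc (i - n)"] by auto
        then show ?thesis using s False \<open>i < n + m\<close> by auto
      qed
    qed (use t w[of m] s in \<open>auto simp: w_def\<close>)
    ultimately show ?thesis by simp
  qed
  let ?P = "\<lambda>x y. {(n::nat, t::nat \<Rightarrow> real). t 0 = x \<and> t n = y \<and> (\<forall>i<n. t i \<le> t (Suc i))}"
  let ?f = "\<lambda>(n, t). \<Sum>i<n. ?d (t i) (t (Suc i))"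
  have ne: "?P x y \<noteq> {}" if "x \<le> y" for x y
  proof -
    have "(1, \<lambda>i. if i = 0 then x else y) \<in> ?P x y" using that by simp
    then show ?thesis by blast
  qed
  have "(SUP z\<in>?P a b. ?f z) + (SUP z\<in>?P b c. ?f z) = (SUP z\<in>?P a b. ?f z + (SUP z\<in>?P b c. ?f z))"
    by (rule ennreal_SUP_add_left[symmetric, OF ne[OF assms(1)]])
  also have "\<dots> \<le> curve_length \<gamma> a c"
  proof (rule SUP_least)
    fix z assume z: "z \<in> ?P a b"
    have "?f z + (SUP z\<in>?P b c. ?f z) = (SUP w\<in>?P b c. ?f z + ?f w)"
      by (rule ennreal_SUP_add_right[OF ne[OF assms(2)]])
    also have "\<dots> \<le> curve_length \<gamma> a c"
      by (rule SUP_least) (use z concat in auto)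
    finally show "?f z + (SUP z\<in>?P b c. ?f z) \<le> curve_length \<gamma> a c" .
  qed
  finally show "curve_length \<gamma> a b + curve_length \<gamma> b c \<le> curve_length \<gamma> a c"
    by (simp only: curve_length_def[of \<gamma> a b] curve_length_def[of \<gamma> b c])
qed

lemma curve_length_refl: "curve_length \<gamma> a a = 0"
proof -
  have "(\<Sum>i<n. ennreal (dist (\<gamma> (t i)) (\<gamma> (t (Suc i))))) \<le> 0"
    if "t 0 = a" "t n = a" "\<forall>i<n. t i \<le> t (Suc i)" for n t
  proof -
    have "t i = a" if "i \<le> n" for i
      using subdivision_bounds[OF \<open>t 0 = a\<close> \<open>t n = a\<close> \<open>\<forall>i<n. t i \<le> t (Suc i)\<close> that] by simp
    then show ?thesis by (simp add: Suc_leI)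
  qed
  then show ?thesis using curve_length_leI[of a a \<gamma> 0] by auto
qed

text \<open>
  Lower semicontinuity of the length in both end points: the polygonal length of a fixed subdivision,
  clipped to a nearby interval, depends continuously on the end points of that interval.
\<close>
lemma curve_length_lsc:
  assumes cont: "continuous_on {0..1} \<gamma>" and ab: "0 \<le> a" "a \<le> b" "b \<le> 1"
    and less: "ennreal s < curve_length \<gamma> a b" and s: "0 \<le> s"
  obtains d where "d > 0"
    "\<And>a' b'. 0 \<le> a' \<Longrightarrow> a' \<le> b' \<Longrightarrow> b' \<le> 1 \<Longrightarrow> \<bar>a' - a\<bar> < d \<Longrightarrow> \<bar>b' - b\<bar> < d \<Longrightarrow>
        ennreal s < curve_length \<gamma> a' b'"
proof -
  obtain n t where t: "t 0 = a" "t n = b" "\<forall>i<n. t i \<le> t (Suc i)"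
    and lt: "ennreal s < (\<Sum>i<n. ennreal (dist (\<gamma> (t i)) (\<gamma> (t (Suc i)))))"
    using less by (rule less_curve_lengthE)
  have n: "n \<noteq> 0" using lt by (intro notI) simp
  \<comment> \<open>The first and last node have to follow the end points even when the interval grows, which clipping
    alone does not achieve.\<close>
  define P where "P i z = (if i = 0 then fst z else if i \<ge> n then snd z else
     max (fst z) (min (snd z) (t i)))" for i and z :: "real \<times> real"
  define S where "S z = (\<Sum>i<n. dist (\<gamma> (P i z)) (\<gamma> (P (Suc i) z)))" for z
  let ?T = "{0..1} \<times> {0..1::real}"
  have Pc: "continuous_on ?T (P i)" for i
    unfolding P_def by (cases "i = 0"; cases "i \<ge> n") (auto intro!: continuous_intros)
  have Pr: "P i ` ?T \<subseteq> {0..1}" if "i \<le> n" for i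
    using subdivision_bounds[OF t that] ab by (auto simp: P_def)
  have "continuous_on ?T (\<lambda>z. \<gamma> (P i z))" if "i \<le> n" for i
    by (rule continuous_on_compose2[OF cont Pc Pr[OF that]])
  then have Sc: "continuous_on ?T S"
    unfolding S_def by (intro continuous_intros) auto
  have Pab: "P i (a, b) = t i" if "i \<le> n" for i
    using subdivision_bounds[OF t that] t that by (auto simp: P_def)
  have "S (a, b) = (\<Sum>i<n. dist (\<gamma> (t i)) (\<gamma> (t (Suc i))))"
    unfolding S_def by (intro sum.cong) (auto simp: Pab)
  then have "ennreal s < ennreal (S (a, b))" using lt by (simp add: sum_ennreal)
  then have gt: "s < S (a, b)" using ennreal_lessI ennreal_leI leD not_le by metis
  obtain d where d: "d > 0" "\<And>z. z \<in> ?T \<Longrightarrow> dist z (a, b) < d \<Longrightarrow> dist (S z) (S (a, b)) < S (a, b) - s"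
    using Sc[unfolded continuous_on_iff, rule_format, of "(a, b)" "S (a, b) - s"] gt ab by auto
  show thesis
  proof (rule that[of "d / 2"])
    fix a' b' :: real
    assume *: "0 \<le> a'" "a' \<le> b'" "b' \<le> 1" "\<bar>a' - a\<bar> < d / 2" "\<bar>b' - b\<bar> < d / 2"
    have "dist (a', b') (a, b) \<le> \<bar>a' - a\<bar> + \<bar>b' - b\<bar>"
      unfolding dist_Pair_Pair dist_real_def by (rule order_trans[OF sqrt_sum_squares_le_sum_abs]) simp
    then have "dist (S (a', b')) (S (a, b)) < S (a, b) - s"
      using * by (intro d) auto
    then have "s < S (a', b')" by (simp add: dist_real_def abs_real_def split: if_splits)
    moreover have "ennreal (S (a', b')) \<le> curve_length \<gamma> a' b'"
    proof -
      have "P i (a', b') \<le> P (Suc i) (a', b')" if "i < n" for i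
        using t(3) that * n by (auto simp: P_def max_def min_def)
      from sum_le_curve_length[of "\<lambda>i. P i (a', b')" a' n b' \<gamma>, OF _ _ this]
      show ?thesis using n by (simp add: P_def S_def sum_ennreal)
    qed
    ultimately show "ennreal s < curve_length \<gamma> a' b'"
      using s ennreal_lessI[of "S (a', b')" s] by (auto intro: less_le_trans)
  qed (use d in auto)
qed

text \<open>
  An intermediate value argument that needs no continuity of the length function: lower semicontinuity
  makes both "the length up to \<open>t\<close> exceeds \<open>s\<close>" and "the length after \<open>t\<close> exceeds \<open>l - s\<close>" open
  conditions on \<open>t\<close>, and by additivity they would split the unit interval if \<open>s\<close> were skipped.
\<close>
lemma arc_length_attained:
  assumes cont: "continuous_on {0..1} \<gamma>" and len: "curve_length \<gamma> 0 1 = ennreal l"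
    and s: "0 \<le> s" "s \<le> l"
  shows "\<exists>t\<in>{0..1}. curve_length \<gamma> 0 t = ennreal s"
proof (rule ccontr)
  assume contra: "\<not> (\<exists>t\<in>{0..1}. curve_length \<gamma> 0 t = ennreal s)"
  define A where "A = {t\<in>{0..1}. ennreal s < curve_length \<gamma> 0 t}"
  define B where "B = {t\<in>{0..1}. ennreal (l - s) < curve_length \<gamma> t 1}"
  have add: "ennreal l = curve_length \<gamma> 0 t + curve_length \<gamma> t 1" if "t \<in> {0..1}" for t
    using curve_length_add[of 0 t 1 \<gamma>] len that by auto
  have B_iff: "ennreal (l - s) < curve_length \<gamma> t 1 \<longleftrightarrow> curve_length \<gamma> 0 t < ennreal s" if "t \<in> {0..1}" for t
  proof -
    have "curve_length \<gamma> 0 t \<noteq> top" "curve_length \<gamma> t 1 \<noteq> top" using add[OF that] by (auto simp: top_add)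
    then obtain x y where xy: "curve_length \<gamma> 0 t = ennreal x" "curve_length \<gamma> t 1 = ennreal y" "x \<ge> 0" "y \<ge> 0"
      by (metis ennreal_cases)
    then have "l = x + y" using add[OF that] s by (simp flip: ennreal_plus)
    then show ?thesis using xy s by (simp add: ennreal_less_iff)
  qed
  have "openin (top_of_set {0..1}) A"
    unfolding openin_euclidean_subtopology_iff
  proof (intro conjI ballI)
    fix t assume "t \<in> A"
    then have t: "0 \<le> t" "t \<le> 1" "ennreal s < curve_length \<gamma> 0 t" by (auto simp: A_def)
    obtain d where "d > 0" "\<And>a' b'. 0 \<le> a' \<Longrightarrow> a' \<le> b' \<Longrightarrow> b' \<le> 1 \<Longrightarrow> \<bar>a' - 0\<bar> < d \<Longrightarrow> \<bar>b' - t\<bar> < d \<Longrightarrow>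
        ennreal s < curve_length \<gamma> a' b'"
      using curve_length_lsc[OF cont _ t(1) t(2) t(3)] s by auto
    then show "\<exists>e>0. \<forall>x'\<in>{0..1}. dist x' t < e \<longrightarrow> x' \<in> A"
      by (intro exI[of _ d]) (auto simp: A_def dist_real_def)
  qed (auto simp: A_def)
  moreover have "openin (top_of_set {0..1}) B"
    unfolding openin_euclidean_subtopology_iff
  proof (intro conjI ballI)
    fix t assume "t \<in> B"
    then have t: "0 \<le> t" "t \<le> 1" "ennreal (l - s) < curve_length \<gamma> t 1" by (auto simp: B_def)
    obtain d where "d > 0" "\<And>a' b'. 0 \<le> a' \<Longrightarrow> a' \<le> b' \<Longrightarrow> b' \<le> 1 \<Longrightarrow> \<bar>a' - t\<bar> < d \<Longrightarrow> \<bar>b' - 1\<bar> < d \<Longrightarrow>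
        ennreal (l - s) < curve_length \<gamma> a' b'"
      using curve_length_lsc[OF cont t(1) t(2) _ t(3)] s by auto
    then show "\<exists>e>0. \<forall>x'\<in>{0..1}. dist x' t < e \<longrightarrow> x' \<in> B"
      by (intro exI[of _ d]) (auto simp: B_def dist_real_def)
  qed (auto simp: B_def)
  moreover have "{0..1} \<subseteq> A \<union> B"
    using contra B_iff by (fastforce simp: A_def B_def)
  moreover have "A \<inter> B = {}"
    using B_iff by (auto simp: A_def B_def)
  moreover have "1 \<in> A"
    using contra len s by (auto simp: A_def ennreal_less_iff order_less_le)
  moreover have "0 \<in> B"
    using contra curve_length_refl[of \<gamma> 0] B_iff[of 0] s by (auto simp: B_def zero_less_iff_neq_zero)
  ultimately show False
    using connected_openin[of "{0..1::real}"] by auto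
qed

lemma arclen_param_lipschitz:
  assumes cont: "continuous_on {0..1} \<gamma>" and len: "curve_length \<gamma> 0 1 = ennreal l" and l: "0 \<le> l"
  shows "1-lipschitz_on {0..l} (arclen_param \<gamma>)"
    and "arclen_param \<gamma> 0 = \<gamma> 0" and "arclen_param \<gamma> l = \<gamma> 1"
    and "s \<in> {0..l} \<Longrightarrow> arclen_param \<gamma> s \<in> \<gamma> ` {0..1}"
proof -
  have ex: "\<exists>t. t \<in> {0..1} \<and> curve_length \<gamma> 0 t = ennreal s \<and> arclen_param \<gamma> s = \<gamma> t"
    if "s \<in> {0..l}" for s
  proof -
    have "\<exists>t. t \<in> {0..1} \<and> curve_length \<gamma> 0 t = ennreal s"
      using arc_length_attained[OF cont len, of s] that by auto
    from someI_ex[OF this] show ?thesis unfolding arclen_param_def by blast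
  qed
  then show "s \<in> {0..l} \<Longrightarrow> arclen_param \<gamma> s \<in> \<gamma> ` {0..1}" by blast
  have le: "dist (\<gamma> t1) (\<gamma> t2) \<le> s2 - s1"
    if "0 \<le> t1" "t1 \<le> t2" "curve_length \<gamma> 0 t1 = ennreal s1" "curve_length \<gamma> 0 t2 = ennreal s2"
      "0 \<le> s1" "0 \<le> s2" for t1 t2 s1 s2
  proof -
    have "ennreal s1 + ennreal (dist (\<gamma> t1) (\<gamma> t2)) \<le> ennreal s2"
      using curve_length_add[of 0 t1 t2 \<gamma>] dist_le_curve_length[of t1 t2 \<gamma>] that by auto
    then have "s1 + dist (\<gamma> t1) (\<gamma> t2) \<le> s2"
      using that by (simp flip: ennreal_plus)
    then show ?thesis by simp
  qed
  have lip: "dist (\<gamma> t1) (\<gamma> t2) \<le> dist s1 s2"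
    if "t1 \<in> {0..1}" "t2 \<in> {0..1}" "curve_length \<gamma> 0 t1 = ennreal s1" "curve_length \<gamma> 0 t2 = ennreal s2"
      "0 \<le> s1" "0 \<le> s2" for t1 t2 s1 s2
    using le[of t1 t2 s1 s2] le[of t2 t1 s2 s1] that
    by (cases "t1 \<le> t2") (auto simp: dist_real_def dist_commute)
  show "1-lipschitz_on {0..l} (arclen_param \<gamma>)"
  proof (rule lipschitz_onI)
    fix s1 s2 assume *: "s1 \<in> {0..l}" "s2 \<in> {0..l}"
    then show "dist (arclen_param \<gamma> s1) (arclen_param \<gamma> s2) \<le> 1 * dist s1 s2"
      using ex[OF *(1)] ex[OF *(2)] lip by fastforce
  qed auto
  obtain t where "t \<in> {0..1}" "curve_length \<gamma> 0 t = ennreal 0" "arclen_param \<gamma> 0 = \<gamma> t"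
    using ex[of 0] l by auto
  then show "arclen_param \<gamma> 0 = \<gamma> 0"
    using lip[of t 0 0 0] curve_length_refl[of \<gamma> 0] by auto
  obtain t where "t \<in> {0..1}" "curve_length \<gamma> 0 t = ennreal l" "arclen_param \<gamma> l = \<gamma> t"
    using ex[of l] l by auto
  then show "arclen_param \<gamma> l = \<gamma> 1"
    using lip[of t 1 l l] len l by auto
qed

section \<open>Radial functions along rectifiable curves\<close>

text \<open>
  A substitute for the fundamental theorem that needs no differentiability of \<open>\<phi>\<close>: up to an error
  \<open>\<epsilon> * (b - a)\<close> the inequality holds on short intervals, where \<open>H\<close> is almost constant, and it is
  additive over adjacent intervals, so Bolzano's principle carries it over to the whole interval.
\<close>
lemma abs_diff_le_integral:
  fixes \<phi> H :: "real \<Rightarrow> real"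
  assumes H: "continuous_on {0..l} H" and l: "0 \<le> l"
    and diff: "\<And>x y. 0 \<le> x \<Longrightarrow> x \<le> y \<Longrightarrow> y \<le> l \<Longrightarrow> \<bar>\<phi> y - \<phi> x\<bar> \<le> (y - x) * max (H x) (H y)"
  shows "\<bar>\<phi> l - \<phi> 0\<bar> \<le> integral {0..l} H"
proof (rule field_le_epsilon)
  fix e :: real assume "e > 0"
  define \<epsilon> where "\<epsilon> = e / (l + 1)"
  have \<epsilon>: "\<epsilon> > 0" "\<epsilon> * l \<le> e" using \<open>e > 0\<close> l by (auto simp: \<epsilon>_def field_simps)
  have int: "H integrable_on {a..b}" if "0 \<le> a" "b \<le> l" for a b
    using H by (rule integrable_on_subinterval[OF integrable_continuous_interval]) (use that in auto)
  have "0 \<le> (0::real) \<longrightarrow> l \<le> l \<longrightarrow> 0 \<le> l \<longrightarrow> \<bar>\<phi> l - \<phi> 0\<bar> \<le> integral {0..l} H + \<epsilon> * (l - 0)"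
  proof (rule Bolzano[where P = "\<lambda>a b. 0 \<le> a \<longrightarrow> b \<le> l \<longrightarrow> a \<le> b \<longrightarrow>
      \<bar>\<phi> b - \<phi> a\<bar> \<le> integral {a..b} H + \<epsilon> * (b - a)"])
    fix a b c :: real
    assume ab: "0 \<le> a \<longrightarrow> b \<le> l \<longrightarrow> a \<le> b \<longrightarrow> \<bar>\<phi> b - \<phi> a\<bar> \<le> integral {a..b} H + \<epsilon> * (b - a)"
      and bc: "0 \<le> b \<longrightarrow> c \<le> l \<longrightarrow> b \<le> c \<longrightarrow> \<bar>\<phi> c - \<phi> b\<bar> \<le> integral {b..c} H + \<epsilon> * (c - b)"
      and le: "a \<le> b" "b \<le> c"
    show "0 \<le> a \<longrightarrow> c \<le> l \<longrightarrow> a \<le> c \<longrightarrow> \<bar>\<phi> c - \<phi> a\<bar> \<le> integral {a..c} H + \<epsilon> * (c - a)"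
    proof (intro impI)
      assume "0 \<le> a" "c \<le> l"
      then have "integral {a..b} H + integral {b..c} H = integral {a..c} H"
        using le by (intro Henstock_Kurzweil_Integration.integral_combine int) auto
      moreover have "\<epsilon> * (c - a) = \<epsilon> * (b - a) + \<epsilon> * (c - b)" by algebra
      ultimately show "\<bar>\<phi> c - \<phi> a\<bar> \<le> integral {a..c} H + \<epsilon> * (c - a)"
        using ab bc le \<open>0 \<le> a\<close> \<open>c \<le> l\<close> by linarith
    qed
  next
    fix x assume x: "0 \<le> x" "x \<le> l"
    then obtain d where d: "d > 0" "\<And>y. y \<in> {0..l} \<Longrightarrow> dist y x < d \<Longrightarrow> dist (H y) (H x) < \<epsilon> / 2"
      using H[unfolded continuous_on_iff, rule_format, of x "\<epsilon> / 2"] \<epsilon> by auto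
    have near: "H x - \<epsilon> / 2 \<le> H y \<and> H y \<le> H x + \<epsilon> / 2" if "0 \<le> y" "y \<le> l" "\<bar>y - x\<bar> < d" for y
    proof -
      have "\<bar>H y - H x\<bar> < \<epsilon> / 2" using d(2)[of y] that unfolding dist_real_def by simp
      then show ?thesis unfolding abs_less_iff by (intro conjI) linarith+
    qed
    show "\<exists>d>0. \<forall>a b. a \<le> x \<and> x \<le> b \<and> b - a < d \<longrightarrow> 0 \<le> a \<longrightarrow> b \<le> l \<longrightarrow> a \<le> b \<longrightarrow>
       \<bar>\<phi> b - \<phi> a\<bar> \<le> integral {a..b} H + \<epsilon> * (b - a)"
    proof (intro exI[of _ d] conjI allI impI)
      fix a b assume *: "a \<le> x \<and> x \<le> b \<and> b - a < d" "0 \<le> a" "b \<le> l" "a \<le> b"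
      have "\<bar>\<phi> b - \<phi> a\<bar> \<le> (b - a) * max (H a) (H b)" by (rule diff) (use * in auto)
      also have "\<dots> \<le> (b - a) * (H x + \<epsilon> / 2)"
      proof (rule mult_left_mono)
        have "\<bar>a - x\<bar> < d" "\<bar>b - x\<bar> < d" "0 \<le> b" "a \<le> l" using * by linarith+
        then show "max (H a) (H b) \<le> H x + \<epsilon> / 2" using near[of a] near[of b] * by simp
      qed (use * in simp)
      also have "\<dots> = (b - a) * (H x - \<epsilon> / 2) + \<epsilon> * (b - a)" by (simp add: field_simps)
      also have "(b - a) * (H x - \<epsilon> / 2) = integral {a..b} (\<lambda>_. H x - \<epsilon> / 2)"
        using * by simp
      also have "\<dots> \<le> integral {a..b} H"
      proof (rule integral_le)
        fix y assume y: "y \<in> {a..b}"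
        then have "\<bar>y - x\<bar> < d" using * by auto
        then show "H x - \<epsilon> / 2 \<le> H y" using near[of y] y * by auto
      qed (use * int in auto)
      finally show "\<bar>\<phi> b - \<phi> a\<bar> \<le> integral {a..b} H + \<epsilon> * (b - a)" by simp
    qed (use d in auto)
  qed (use l in auto)
  then show "\<bar>\<phi> l - \<phi> 0\<bar> \<le> integral {0..l} H + e" using \<epsilon> l by simp
qed

lemma diff_le_max_powr:
  fixes F :: "real \<Rightarrow> real"
  assumes F: "\<And>s. 0 < s \<Longrightarrow> (F has_real_derivative - (s powr - b)) (at s)"
    and b: "0 \<le> b" and pos: "0 < x" "0 < y"
  shows "\<bar>F y - F x\<bar> \<le> \<bar>y - x\<bar> * max (x powr - b) (y powr - b)"
  using pos
proof (induction x y rule: linorder_wlog)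
  case (le x y)
  show ?case
  proof (cases "x = y")
    case False
    then obtain z where z: "x < z" "z < y" "F y - F x = (y - x) * - (z powr - b)"
      using MVT2[of x y F "\<lambda>s. - (s powr - b)"] F le by force
    then have "z powr - b \<le> x powr - b"
      using le b by (intro powr_mono2') auto
    then show ?thesis using z le by (auto simp: abs_mult intro!: mult_left_mono)
  qed auto
next
  case (sym x y)
  then show ?case by (simp add: abs_minus_commute max.commute)
qed

text \<open>
  For a radial function with profile \<open>F\<close> the radial derivative is an upper gradient along every
  rectifiable curve, without exceptions. Along the arc length parametrization the distance to the origin is
  1-Lipschitz, and it stays away from 0 since the curve is compact.
\<close>
lemma radial_upper_gradient:
  fixes \<gamma> :: "real \<Rightarrow> 'a :: euclidean_space"
  assumes F: "\<And>s. 0 < s \<Longrightarrow> (F has_real_derivative - (s powr - b)) (at s)"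
    and b: "0 \<le> b" and \<gamma>: "\<gamma> \<in> rect_curves X" and X: "0 \<notin> X"
  shows "ennreal \<bar>F (norm (pathstart \<gamma>)) - F (norm (pathfinish \<gamma>))\<bar>
           \<le> curve_integral \<gamma> (\<lambda>x. ennreal (norm x powr - b))"
proof -
  have cont: "continuous_on {0..1} \<gamma>" and im: "\<gamma> ` {0..1} \<subseteq> X" and fin: "curve_length \<gamma> 0 1 < top"
    using \<gamma> by (auto simp: rect_curves_def path_def path_image_def)
  obtain l where l: "curve_length \<gamma> 0 1 = ennreal l" "0 \<le> l" using fin by (cases "curve_length \<gamma> 0 1") auto
  note arc = arclen_param_lipschitz[OF cont l]
  define \<alpha> where "\<alpha> = (\<lambda>s. norm (arclen_param \<gamma> s))"
  have pos: "\<alpha> s > 0" if "s \<in> {0..l}" for s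
    using arc(4)[OF that] im X by (auto simp: \<alpha>_def)
  have lip: "\<bar>\<alpha> y - \<alpha> x\<bar> \<le> y - x" if "x \<in> {0..l}" "y \<in> {0..l}" "x \<le> y" for x y
  proof -
    have "\<bar>\<alpha> y - \<alpha> x\<bar> \<le> dist (arclen_param \<gamma> y) (arclen_param \<gamma> x)"
      unfolding \<alpha>_def dist_norm by (rule norm_triangle_ineq3)
    also have "\<dots> \<le> y - x" using lipschitz_onD[OF arc(1) that(2,1)] that by (simp add: dist_real_def)
    finally show ?thesis .
  qed
  have "continuous_on {0..l} \<alpha>"
    unfolding \<alpha>_def by (intro continuous_intros lipschitz_on_continuous_on[OF arc(1)])
  then have H: "continuous_on {0..l} (\<lambda>s. \<alpha> s powr - b)"
    by (intro continuous_intros) (use pos in force)+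
  have "\<bar>F (\<alpha> l) - F (\<alpha> 0)\<bar> \<le> integral {0..l} (\<lambda>s. \<alpha> s powr - b)"
  proof (rule abs_diff_le_integral[OF H l(2)])
    fix x y assume xy: "0 \<le> x" "x \<le> y" "y \<le> l"
    have "\<bar>F (\<alpha> y) - F (\<alpha> x)\<bar> \<le> \<bar>\<alpha> y - \<alpha> x\<bar> * max (\<alpha> x powr - b) (\<alpha> y powr - b)"
      by (rule diff_le_max_powr[OF F b]) (use pos xy in auto)
    also have "\<dots> \<le> (y - x) * max (\<alpha> x powr - b) (\<alpha> y powr - b)"
      by (intro mult_right_mono lip) (use xy in \<open>auto simp: le_max_iff_disj\<close>)
    finally show "\<bar>F (\<alpha> y) - F (\<alpha> x)\<bar> \<le> (y - x) * max (\<alpha> x powr - b) (\<alpha> y powr - b)" .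
  qed
  moreover have "curve_integral \<gamma> (\<lambda>x. ennreal (norm x powr - b)) = ennreal (integral {0..l} (\<lambda>s. \<alpha> s powr - b))"
    unfolding curve_integral_def l \<alpha>_def[symmetric] enn2real_ennreal[OF l(2)]
    using nn_integral_has_integral_lebesgue'[OF _ integrable_integral[OF integrable_continuous_interval[OF H]]]
    by (simp add: \<alpha>_def)
  ultimately show ?thesis
    by (auto simp: \<alpha>_def arc pathstart_def pathfinish_def abs_minus_commute intro!: ennreal_leI)
qed

section \<open>Averages of curve integrals over radial segments\<close>

lemma curve_length_linepath:
  assumes "0 \<le> t"
  shows "curve_length (linepath x y) 0 t = ennreal (t * dist x y)"
proof (rule antisym)
  have d: "dist (linepath x y a) (linepath x y b) = \<bar>b - a\<bar> * dist x y" for a b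
  proof -
    have "linepath x y b - linepath x y a = (b - a) *\<^sub>R (y - x)"
      by (simp add: linepath_def algebra_simps)
    then show ?thesis by (metis dist_commute dist_norm norm_scaleR)
  qed
  show "curve_length (linepath x y) 0 t \<le> ennreal (t * dist x y)"
  proof (rule curve_length_leI)
    fix n and \<tau> :: "nat \<Rightarrow> real"
    assume *: "\<tau> 0 = 0" "\<tau> n = t" "\<forall>i<n. \<tau> i \<le> \<tau> (Suc i)"
    have "(\<Sum>i<n. dist (linepath x y (\<tau> i)) (linepath x y (\<tau> (Suc i)))) =
      (\<Sum>i<n. \<tau> (Suc i) - \<tau> i) * dist x y"
      unfolding sum_distrib_right by (intro sum.cong) (use * in \<open>auto simp: d\<close>)
    also have "(\<Sum>i<n. \<tau> (Suc i) - \<tau> i) = t" using * by (simp add: sum_lessThan_telescope)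
    finally show "(\<Sum>i<n. ennreal (dist (linepath x y (\<tau> i)) (linepath x y (\<tau> (Suc i))))) \<le> ennreal (t * dist x y)"
      by (simp add: sum_ennreal)
  qed
  show "ennreal (t * dist x y) \<le> curve_length (linepath x y) 0 t"
    using dist_le_curve_length[OF assms, of "linepath x y"] assms unfolding d by simp
qed

lemma arclen_param_linepath:
  assumes "x \<noteq> y" "s \<in> {0..dist x y}"
  shows "arclen_param (linepath x y) s = linepath x y (s / dist x y)"
proof -
  have "(SOME t. t \<in> {0..1} \<and> curve_length (linepath x y) 0 t = ennreal s) = s / dist x y"
  proof (rule some_equality)
    fix t assume "t \<in> {0..1} \<and> curve_length (linepath x y) 0 t = ennreal s"
    then have "t * dist x y = s" using assms by (auto simp: curve_length_linepath)
    then show "t = s / dist x y" using assms by auto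
  qed (use assms in \<open>auto simp: curve_length_linepath\<close>)
  then show ?thesis unfolding arclen_param_def by simp
qed

lemma linepath_rect_curves:
  assumes "x \<noteq> y" "closed_segment x y \<subseteq> X"
  shows "linepath x y \<in> rect_curves X"
proof -
  have "linepath x y 0 \<noteq> linepath x y 1" using assms by (simp add: linepath_def)
  then have "\<not> linepath x y constant_on {0..1}"
    unfolding constant_on_def by (metis atLeastAtMost_iff order_refl zero_le_one)
  then show ?thesis using assms by (simp add: rect_curves_def curve_length_linepath)
qed

lemma curve_integral_linepath:
  fixes x y :: "'a::euclidean_space"
  assumes "x \<noteq> y" and \<rho>: "\<rho> \<in> borel_measurable (restrict_space borel X)"
    and X: "X \<in> sets borel" "closed_segment x y \<subseteq> X"
  shows "curve_integral (linepath x y) \<rho> =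
     ennreal (dist x y) * (\<integral>\<^sup>+t\<in>{0..1}. \<rho> (linepath x y t) * indicator X (linepath x y t) \<partial>lborel)"
proof -
  define \<rho>' where "\<rho>' = (\<lambda>z. \<rho> z * indicator X z)"
  have [measurable]: "\<rho>' \<in> borel_measurable borel"
    using \<rho> X by (simp add: borel_measurable_restrict_space_iff_ennreal \<rho>'_def)
  have [measurable]: "linepath x y \<in> borel_measurable borel"
    by (intro borel_measurable_continuous_onI) (auto intro!: continuous_intros simp: linepath_def[abs_def])
  define d where "d = dist x y"
  have d: "d > 0" using assms by (simp add: d_def)
  define G where "G = (\<lambda>s. \<rho>' (linepath x y (s / d)) * indicator {0..d} s)"
  have [measurable]: "G \<in> borel_measurable borel" unfolding G_def by measurable
  have "curve_integral (linepath x y) \<rho> = (\<integral>\<^sup>+s. G s \<partial>lborel)"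
    unfolding curve_integral_def curve_length_linepath[OF zero_le_one] G_def
  proof (intro nn_integral_cong)
    fix s
    show "\<rho> (arclen_param (linepath x y) s) * indicator {0..enn2real (ennreal (1 * dist x y))} s =
         \<rho>' (linepath x y (s / d)) * indicator {0..d} s"
    proof (cases "s \<in> {0..d}")
      case True
      then have "s / d \<in> {0..1}" using d by simp
      then have "linepath x y (s / d) \<in> X" using X linepath_image_01 by blast
      then show ?thesis using True arclen_param_linepath[OF assms(1)] by (simp add: \<rho>'_def d_def)
    qed (simp add: d_def)
  qed
  also have "\<dots> = ennreal \<bar>d\<bar> * (\<integral>\<^sup>+t. G (0 + d * t) \<partial>lborel)"
    by (rule nn_integral_real_affine) (use d in auto)
  also have "(\<integral>\<^sup>+t. G (0 + d * t) \<partial>lborel) = (\<integral>\<^sup>+t\<in>{0..1}. \<rho>' (linepath x y t) \<partial>lborel)"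
    by (intro nn_integral_cong) (use d in \<open>auto simp: G_def indicator_def zero_le_mult_iff\<close>)
  finally show ?thesis using d by (simp add: \<rho>'_def d_def)
qed

text \<open>The Jacobian factor \<open>c ^ DIM('a)\<close> of the dilation is at least 1 and is dropped.\<close>
lemma nn_integral_lborel_dilation_le:
  fixes f :: "'a::euclidean_space \<Rightarrow> ennreal"
  assumes [measurable]: "f \<in> borel_measurable borel" and c: "1 \<le> c"
  shows "(\<integral>\<^sup>+x. f (c *\<^sub>R x) \<partial>lborel) \<le> (\<integral>\<^sup>+x. f x \<partial>lborel)"
proof -
  have "(\<integral>\<^sup>+x. f x \<partial>lborel) = (\<integral>\<^sup>+x. f x \<partial>density (distr lborel borel (\<lambda>x::'a. 0 + c *\<^sub>R x)) (\<lambda>_. ennreal (\<bar>c\<bar> ^ DIM('a))))"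
    using lborel_affine[of c "0::'a"] c by simp
  also have "\<dots> = ennreal (c ^ DIM('a)) * (\<integral>\<^sup>+x. f (c *\<^sub>R x) \<partial>lborel)"
    using c by (simp add: nn_integral_density nn_integral_distr nn_integral_cmult)
  also have "1 * (\<integral>\<^sup>+x. f (c *\<^sub>R x) \<partial>lborel) \<le> \<dots>"
    using c by (intro mult_right_mono) (auto simp: one_le_power ennreal_1[symmetric] simp del: ennreal_1 intro!: ennreal_leI)
  finally show ?thesis by simp
qed

text \<open>
  For \<open>x\<close> near 0 this is the curve integral of \<open>\<rho>\<close> over the segment from \<open>x\<close> to \<open>2 *\<^sub>R x\<close>. Unlike
  \<^const>\<open>curve_integral\<close> it is visibly measurable in \<open>x\<close>.
\<close>
definition dilation_integral :: "'a::euclidean_space set \<Rightarrow> ('a \<Rightarrow> ennreal) \<Rightarrow> 'a \<Rightarrow> ennreal" where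
  "dilation_integral X \<rho> x =
     ennreal (norm x) * (\<integral>\<^sup>+t\<in>{0..1}. \<rho> ((1 + t) *\<^sub>R x) * indicator X ((1 + t) *\<^sub>R x) \<partial>lborel)"

lemma borel_measurable_dilation_integral [measurable]:
  assumes "\<rho> \<in> borel_measurable (restrict_space borel X)" "X \<in> sets borel"
  shows "dilation_integral X \<rho> \<in> borel_measurable borel"
proof -
  have [measurable]: "(\<lambda>z. \<rho> z * indicator X z) \<in> borel_measurable borel"
    using assms by (simp add: borel_measurable_restrict_space_iff_ennreal)
  show ?thesis unfolding dilation_integral_def[abs_def] by measurable
qed

text \<open>
  Fubini's theorem together with dilations of Lebesgue measure: integrating first over \<open>x\<close> and then
  over the position \<open>t\<close> on the segment turns the family of radial segments into a volume integral, without
  polar coordinates.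
\<close>
lemma nn_integral_dilation_integral_le:
  fixes \<rho> :: "'a::euclidean_space \<Rightarrow> ennreal"
  assumes \<rho>: "\<rho> \<in> borel_measurable (restrict_space borel X)" "X \<in> sets borel" and r: "0 < r"
  shows "(\<integral>\<^sup>+x\<in>ball 0 r. dilation_integral X \<rho> x \<partial>lborel) \<le> ennreal r * (\<integral>\<^sup>+x\<in>ball 0 (2 * r). \<rho> x \<partial>lebesgue_on X)"
proof -
  define h where "h = (\<lambda>z. \<rho> z * indicator X z)"
  have h[measurable]: "h \<in> borel_measurable borel"
    using \<rho> by (simp add: borel_measurable_restrict_space_iff_ennreal h_def)
  define h2 where "h2 = (\<lambda>z. h z * indicator (ball 0 (2 * r)) z)"
  have [measurable]: "ball (0::'a) (2 * r) \<in> sets borel" by simp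
  have [measurable]: "h2 \<in> borel_measurable borel" unfolding h2_def by measurable
  have "(\<integral>\<^sup>+x\<in>ball 0 r. dilation_integral X \<rho> x \<partial>lborel) \<le>
      (\<integral>\<^sup>+x. ennreal r * (\<integral>\<^sup>+t. indicator {0..1} t * h2 ((1 + t) *\<^sub>R x) \<partial>lborel) \<partial>lborel)"
  proof (rule nn_integral_mono)
    fix x :: 'a
    show "dilation_integral X \<rho> x * indicator (ball 0 r) x \<le>
       ennreal r * (\<integral>\<^sup>+t. indicator {0..1} t * h2 ((1 + t) *\<^sub>R x) \<partial>lborel)"
    proof (cases "norm x < r")
      case True
      have "(\<integral>\<^sup>+t\<in>{0..1}. h ((1 + t) *\<^sub>R x) \<partial>lborel) \<le> (\<integral>\<^sup>+t. indicator {0..1} t * h2 ((1 + t) *\<^sub>R x) \<partial>lborel)"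
      proof (rule nn_integral_mono)
        fix t :: real
        show "h ((1 + t) *\<^sub>R x) * indicator {0..1} t \<le> indicator {0..1} t * h2 ((1 + t) *\<^sub>R x)"
        proof (cases "t \<in> {0..1}")
          case t: True
          then have "(1 + t) * norm x \<le> 2 * norm x" by (intro mult_right_mono) auto
          then have "norm ((1 + t) *\<^sub>R x) < 2 * r" using t True by simp
          then show ?thesis using t by (simp add: h2_def)
        qed simp
      qed
      then show ?thesis unfolding dilation_integral_def h_def[symmetric]
        using True by (auto simp: h_def indicator_def intro!: mult_mono ennreal_leI)
    qed simp
  qed
  also have "\<dots> = ennreal r * (\<integral>\<^sup>+t. (\<integral>\<^sup>+x. indicator {0..1} t * h2 ((1 + t) *\<^sub>R x) \<partial>(lborel :: 'a measure)) \<partial>lborel)"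
    by (subst nn_integral_cmult) (auto intro!: arg_cong[where f = "(*) (ennreal r)"] lborel_pair.Fubini')
  also have "\<dots> \<le> ennreal r * (\<integral>\<^sup>+t. indicator {0..1::real} t * (\<integral>\<^sup>+x. h2 x \<partial>lborel) \<partial>lborel)"
  proof (rule mult_left_mono, rule nn_integral_mono)
    fix t :: real
    show "(\<integral>\<^sup>+x. indicator {0..1} t * h2 ((1 + t) *\<^sub>R x) \<partial>lborel) \<le> indicator {0..1} t * (\<integral>\<^sup>+x. h2 x \<partial>lborel)"
      using nn_integral_lborel_dilation_le[of h2 "1 + t"] by (auto simp: indicator_def)
  qed auto
  also have "(\<integral>\<^sup>+t. indicator {0..1::real} t * (\<integral>\<^sup>+x. h2 x \<partial>lborel) \<partial>lborel) = (\<integral>\<^sup>+x. h2 x \<partial>lborel)"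
    by (simp add: nn_integral_multc)
  also have "\<dots> = (\<integral>\<^sup>+x\<in>ball 0 (2 * r). \<rho> x \<partial>lebesgue_on X)"
    using \<rho>(2) by (simp add: nn_integral_restrict_space nn_integral_completion h2_def h_def mult_ac)
  finally show ?thesis .
qed

section \<open>The radial singularity as an element of the Newtonian space\<close>

text \<open>
  The power \<open>b = n / p\<close> is exactly critical: the set where \<open>norm x powr - b\<close> exceeds \<open>t\<close> is a ball of
  measure proportional to \<open>t powr - p\<close>, so the function is in weak \<open>L\<^sup>p\<close>, and it has the same size in
  weak \<open>L\<^sup>p\<close> on every ball around 0.
\<close>
lemma weak_norm_powr_le:
  fixes X :: "'a::euclidean_space set"
  assumes X: "X \<in> sets lebesgue" "0 \<notin> X" and p: "0 < p" and b: "b = real DIM('a) / p"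
    and f: "\<And>x. x \<in> X \<Longrightarrow> \<bar>f x\<bar> \<le> ereal (norm x powr - b)"
  shows "weak_norm p (lebesgue_on X) f \<le> ennreal (unit_ball_vol (real DIM('a)) powr (1 / p))"
  unfolding weak_norm_def
proof (rule SUP_least)
  fix t :: real assume "t \<in> {0<..}"
  then have t: "0 < t" by simp
  define \<omega> where "\<omega> = unit_ball_vol (real DIM('a))"
  have \<omega>: "\<omega> \<ge> 0" unfolding \<omega>_def by simp
  have b0: "b > 0" using p b by simp
  define r where "r = t powr - (1 / b)"
  have r: "r > 0" using t by (simp add: r_def)
  have "{x \<in> space (lebesgue_on X). \<bar>f x\<bar> > ereal t} \<subseteq> X \<inter> ball 0 r"
  proof
    fix x assume "x \<in> {x \<in> space (lebesgue_on X). \<bar>f x\<bar> > ereal t}"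
    then have x: "x \<in> X" "ereal t < ereal (norm x powr - b)"
      using f[of x] less_le_trans[of "ereal t" "\<bar>f x\<bar>" "ereal (norm x powr - b)"]
      by (simp_all add: space_restrict_space)
    then have "(norm x powr - b) powr - (1 / b) < t powr - (1 / b)"
      using t b0 by (intro powr_less_mono2_neg) auto
    moreover have "x \<noteq> 0" using x X by auto
    ultimately show "x \<in> X \<inter> ball 0 r"
      using x b0 by (simp add: powr_powr r_def)
  qed
  then have "emeasure (lebesgue_on X) {x \<in> space (lebesgue_on X). \<bar>f x\<bar> > ereal t} \<le> emeasure (lebesgue_on X) (X \<inter> ball 0 r)"
    by (rule emeasure_mono) (use X in \<open>auto simp: sets_restrict_space\<close>)
  also have "\<dots> = emeasure lebesgue (X \<inter> ball 0 r)"
    using X by (subst emeasure_restrict_space) auto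
  also have "\<dots> \<le> emeasure lebesgue (ball (0::'a) r)" by (rule emeasure_mono) auto
  also have "\<dots> = ennreal (\<omega> * r ^ DIM('a))"
    using emeasure_ball[of r "0::'a"] r by (simp add: emeasure_completion \<omega>_def)
  also have "r ^ DIM('a) = t powr - p"
    using r t p b unfolding r_def by (simp add: powr_powr flip: powr_realpow)
  finally have "ennreal t * ennreal_powr (emeasure (lebesgue_on X) {x \<in> space (lebesgue_on X). \<bar>f x\<bar> > ereal t}) (1 / p)
     \<le> ennreal t * ennreal_powr (ennreal (\<omega> * t powr - p)) (1 / p)"
    using p by (intro mult_left_mono ennreal_powr_mono) auto
  also have "ennreal_powr (ennreal (\<omega> * t powr - p)) (1 / p) = ennreal (\<omega> powr (1 / p) / t)"
    using \<omega> t p by (simp add: ennreal_powr_def powr_mult powr_powr powr_minus_divide powr_divide)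
  also have "ennreal t * \<dots> = ennreal (\<omega> powr (1 / p))"
    using t by (simp flip: ennreal_mult)
  finally show "ennreal t * ennreal_powr (emeasure (lebesgue_on X) {x \<in> space (lebesgue_on X). \<bar>f x\<bar> > ereal t}) (1 / p)
     \<le> ennreal (unit_ball_vol (real DIM('a)) powr (1 / p))"
    by (simp add: \<omega>_def)
qed

lemma weak_norm_zero:
  assumes "0 < p" shows "weak_norm p M (\<lambda>_. 0) = 0"
proof -
  have "weak_norm p M (\<lambda>_. 0) \<le> 0"
    unfolding weak_norm_def by (rule SUP_least) (auto simp: ennreal_powr_def)
  then show ?thesis by simp
qed

lemma almost_every_curveI:
  fixes X :: "'a::euclidean_space set"
  assumes "0 < p" "\<And>\<gamma>. \<gamma> \<in> rect_curves X \<Longrightarrow> P \<gamma>"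
  shows "almost_every_curve p X P"
proof -
  have "(\<lambda>_. 0) \<in> admissible X {}" by (simp add: admissible_def)
  then have "modulus p X {} \<le> ennreal_powr (weak_norm p (lebesgue_on X) (enn2ereal \<circ> (\<lambda>_. 0))) p"
    unfolding modulus_def by (rule INF_lower)
  also have "enn2ereal \<circ> (\<lambda>_. 0) = (\<lambda>_::'a. 0)" by (simp add: comp_def zero_ennreal.rep_eq)
  also have "ennreal_powr (weak_norm p (lebesgue_on X) (\<lambda>_. 0)) p = 0"
    unfolding weak_norm_zero[OF assms(1)] by (simp add: ennreal_powr_def)
  finally show ?thesis unfolding almost_every_curve_def using assms(2) by (intro exI[of _ "{}"]) auto
qed

lemma borel_measurable_lebesgue_onI:
  assumes "f \<in> borel_measurable (restrict_space borel X)"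
  shows "f \<in> borel_measurable (lebesgue_on X)"
proof -
  have "(\<lambda>x. x) \<in> lebesgue_on X \<rightarrow>\<^sub>M restrict_space borel X"
    by (intro measurable_restrict_space3 measurable_completion) auto
  from measurable_compose[OF this assms] show ?thesis by simp
qed

text \<open>
  The logarithm for \<open>b = 1\<close>, a power otherwise. Only the derivative and the value at 1 matter later, which
  avoids a distinction between \<open>p = n\<close> and \<open>p < n\<close>.
\<close>
lemma ex_powr_antiderivative:
  fixes b :: real
  obtains F :: "real \<Rightarrow> real"
  where "\<forall>s>0. (F has_real_derivative - (s powr - b)) (at s)" "F 1 = 0"
proof (cases "b = 1")
  case True
  show thesis
    by (rule that[of "\<lambda>s. - ln s"])
      (use True in \<open>auto intro!: derivative_eq_intros simp: powr_minus_divide divide_simps\<close>)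
next
  case False
  show thesis
  proof (rule that[of "\<lambda>s. (s powr (1 - b) - 1) / (b - 1)"], intro allI impI)
    fix s :: real assume "0 < s"
    then have "((\<lambda>s. (s powr (1 - b) - 1) / (b - 1)) has_real_derivative (1 - b) * s powr (1 - b - 1) / (b - 1)) (at s)"
      using False by (auto intro!: derivative_eq_intros)
    also have "(1 - b) * s powr (1 - b - 1) / (b - 1) = - (s powr - b)"
      using False by (simp add: field_simps)
    finally show "((\<lambda>s. (s powr (1 - b) - 1) / (b - 1)) has_real_derivative - (s powr - b)) (at s)" .
  qed simp
qed

lemma powr_antiderivative_bound:
  fixes F :: "real \<Rightarrow> real"
  assumes F: "\<And>s. 0 < s \<Longrightarrow> (F has_real_derivative - (s powr - b)) (at s)" and F1: "F 1 = 0"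
    and b: "0 < b" and s: "0 < s" "s < 1"
  shows "\<bar>F s\<bar> \<le> s powr - b"
proof -
  have "1 \<le> s powr - b"
    using s b powr_mono2'[of "-b" s 1] by simp
  then have max: "max (s powr - b) (1 powr - b) = s powr - b" by simp
  have "\<bar>F 1 - F s\<bar> \<le> \<bar>1 - s\<bar> * max (s powr - b) (1 powr - b)"
    by (rule diff_le_max_powr[OF F]) (use s b in auto)
  also have "\<dots> \<le> 1 * s powr - b"
    unfolding max by (intro mult_right_mono) (use s in auto)
  finally show ?thesis using F1 by simp
qed

lemma radial_singularity_in_pre_newtonian:
  fixes X :: "'a::euclidean_space set" and F :: "real \<Rightarrow> real"
  assumes X: "X = ball 0 1 - {0}" and p: "1 < p" and b: "b = real DIM('a) / p"
    and F: "\<And>s. 0 < s \<Longrightarrow> (F has_real_derivative - (s powr - b)) (at s)" and F1: "F 1 = 0"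
  shows "(\<lambda>x. ereal (F (norm x))) \<in> pre_newtonian p X"
proof -
  have b_pos: "0 < b" using p b by simp
  have X_sets: "X \<in> sets lebesgue" by (simp add: X)
  have "continuous_on {0<..} F"
    using F by (intro continuous_at_imp_continuous_on) (auto intro: DERIV_isCont)
  then have "continuous_on X (\<lambda>x. F (norm x))"
    by (rule continuous_on_compose2) (auto intro!: continuous_intros simp: X)
  then have "(\<lambda>x. F (norm x)) \<in> borel_measurable (restrict_space borel X)"
    by (rule borel_measurable_continuous_on_restrict)
  then have u: "(\<lambda>x. ereal (F (norm x))) \<in> borel_measurable (restrict_space borel X)"
    by measurable
  define g where "g = (\<lambda>x::'a. ennreal (norm x powr - b))"
  have g: "g \<in> borel_measurable (restrict_space borel X)"
    unfolding g_def by (intro measurable_restrict_space1) measurable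
  have "weak_norm p (lebesgue_on X) (\<lambda>x. ereal (F (norm x))) \<le> ennreal (unit_ball_vol (real DIM('a)) powr (1 / p))"
    by (rule weak_norm_powr_le[OF X_sets _ _ b]) (use p in \<open>auto simp: X intro!: powr_antiderivative_bound[OF F F1 b_pos]\<close>)
  then have "(\<lambda>x. ereal (F (norm x))) \<in> weak_Lp p (lebesgue_on X)"
    using u by (auto simp: weak_Lp_def borel_measurable_lebesgue_onI intro: le_less_trans)
  moreover have "weak_norm p (lebesgue_on X) (enn2ereal \<circ> g) \<le> ennreal (unit_ball_vol (real DIM('a)) powr (1 / p))"
    by (rule weak_norm_powr_le[OF X_sets _ _ b]) (use p in \<open>auto simp: X g_def enn2ereal_ennreal\<close>)
  then have "enn2ereal \<circ> g \<in> weak_Lp p (lebesgue_on X)"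
    using borel_measurable_lebesgue_onI[OF g]
    by (auto simp: weak_Lp_def comp_def intro: le_less_trans)
  moreover have "weak_upper_gradient p X (\<lambda>x. ereal (F (norm x))) g"
    unfolding weak_upper_gradient_def
    using p g radial_upper_gradient[OF F less_imp_le[OF b_pos], of _ X]
    by (auto intro!: almost_every_curveI simp: g_def[symmetric] e2ennreal_ereal X)
  ultimately show ?thesis
    using u by (auto simp: pre_newtonian_def Lp_weak_upper_gradients_def)
qed

section \<open>Weak upper gradients of differences\<close>

text \<open>
  The quantity that a weak upper gradient of \<open>w\<close> dominates along almost every curve from \<open>x\<close> to \<open>y\<close>.
\<close>
definition end_gap :: "('a \<Rightarrow> ereal) \<Rightarrow> 'a \<Rightarrow> 'a \<Rightarrow> ennreal" where
  "end_gap w x y = (if \<bar>w x\<bar> \<noteq> \<infinity> \<and> \<bar>w y\<bar> \<noteq> \<infinity> then e2ennreal \<bar>w x - w y\<bar> else \<infinity>)"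

lemma modulus_zeroE:
  assumes "modulus p X \<Gamma> = 0" and p: "0 < p" and \<eta>: "0 < \<eta>"
  obtains \<rho> where "\<rho> \<in> admissible X \<Gamma>" "weak_norm p (lebesgue_on X) (enn2ereal \<circ> \<rho>) \<le> ennreal \<eta>"
proof -
  have "modulus p X \<Gamma> < ennreal (\<eta> powr p)" using assms by simp
  then obtain \<rho> where \<rho>: "\<rho> \<in> admissible X \<Gamma>"
    "ennreal_powr (weak_norm p (lebesgue_on X) (enn2ereal \<circ> \<rho>)) p < ennreal (\<eta> powr p)"
    unfolding modulus_def INF_less_iff by auto
  from ennreal_powr_lessD[OF \<rho>(2) p] \<eta> p show thesis
    by (intro that[OF \<rho>(1)]) (simp add: powr_powr)
qed

text \<open>
  The exceptional family of a weak upper gradient is absorbed into an admissible function \<open>\<rho>\<close> whose norm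
  can be prescribed independently of \<open>\<epsilon>\<close>. This avoids asking whether the set of all \<open>x\<close> with
  an exceptional segment is measurable.
\<close>
lemma newtonian_norm_lessE:
  assumes norm: "newtonian_norm p X w < ennreal \<epsilon>" and p: "0 < p" and \<epsilon>: "0 < \<epsilon>" and \<eta>: "0 < \<eta>"
  obtains g \<rho> where "g \<in> borel_measurable (restrict_space borel X)"
    "\<rho> \<in> borel_measurable (restrict_space borel X)"
    "weak_norm p (lebesgue_on X) (enn2ereal \<circ> g) \<le> ennreal \<epsilon>"
    "weak_norm p (lebesgue_on X) (enn2ereal \<circ> \<rho>) \<le> ennreal \<eta>"
    "\<forall>\<gamma>\<in>rect_curves X. 1 \<le> curve_integral \<gamma> \<rho> \<or>
       end_gap w (pathstart \<gamma>) (pathfinish \<gamma>) \<le> curve_integral \<gamma> g"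
proof -
  let ?I = "INF g\<in>Lp_weak_upper_gradients p X w. ennreal_powr (weak_norm p (lebesgue_on X) (enn2ereal \<circ> g)) p"
  have "ennreal_powr (weak_norm p (lebesgue_on X) w) p + ?I < ennreal (\<epsilon> powr (1 / (1 / p)))"
    using norm unfolding newtonian_norm_def by (rule ennreal_powr_lessD) (use p \<epsilon> in auto)
  then have "?I < ennreal (\<epsilon> powr p)"
    by (auto intro: le_less_trans[rotated])
  then obtain g where g: "g \<in> Lp_weak_upper_gradients p X w"
    "ennreal_powr (weak_norm p (lebesgue_on X) (enn2ereal \<circ> g)) p < ennreal (\<epsilon> powr p)"
    unfolding INF_less_iff by blast
  have gN: "weak_norm p (lebesgue_on X) (enn2ereal \<circ> g) \<le> ennreal \<epsilon>"
    using ennreal_powr_lessD[OF g(2) p] \<epsilon> p by (simp add: powr_powr)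
  from g(1) obtain \<Gamma> where gm: "g \<in> borel_measurable (restrict_space borel X)"
    and \<Gamma>: "modulus p X \<Gamma> = 0"
    and ug: "\<And>\<gamma>. \<gamma> \<in> rect_curves X - \<Gamma> \<Longrightarrow>
       (if \<bar>w (pathstart \<gamma>)\<bar> \<noteq> \<infinity> \<and> \<bar>w (pathfinish \<gamma>)\<bar> \<noteq> \<infinity>
       then e2ennreal \<bar>w (pathstart \<gamma>) - w (pathfinish \<gamma>)\<bar> \<le> curve_integral \<gamma> g
       else curve_integral \<gamma> g = \<infinity>)"
    unfolding Lp_weak_upper_gradients_def weak_upper_gradient_def almost_every_curve_def by blast
  obtain \<rho> where \<rho>: "\<rho> \<in> admissible X \<Gamma>" "weak_norm p (lebesgue_on X) (enn2ereal \<circ> \<rho>) \<le> ennreal \<eta>"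
    by (rule modulus_zeroE[OF \<Gamma> p \<eta>])
  show thesis
  proof (rule that[OF gm _ gN \<rho>(2)])
    show "\<rho> \<in> borel_measurable (restrict_space borel X)" using \<rho> by (simp add: admissible_def)
    show "\<forall>\<gamma>\<in>rect_curves X. 1 \<le> curve_integral \<gamma> \<rho> \<or>
        end_gap w (pathstart \<gamma>) (pathfinish \<gamma>) \<le> curve_integral \<gamma> g"
    proof
      fix \<gamma> assume "\<gamma> \<in> rect_curves X"
      then show "1 \<le> curve_integral \<gamma> \<rho> \<or> end_gap w (pathstart \<gamma>) (pathfinish \<gamma>) \<le> curve_integral \<gamma> g"
        using \<rho>(1) ug[of \<gamma>] by (cases "\<gamma> \<in> \<Gamma>") (auto simp: admissible_def end_gap_def split: if_splits)
    qed
  qed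
qed

text \<open>
  The representatives \<open>u'\<close> and \<open>v'\<close> may be infinite, but \<open>u\<close> and \<open>v\<close> are not; so an infinite value
  of a representative at an end point already makes the first or the last gap infinite.
\<close>
lemma end_gap_triangle:
  fixes u v :: "'a \<Rightarrow> real"
  shows "ennreal \<bar>(u x - u y) - (v x - v y)\<bar> \<le>
    end_gap (\<lambda>x. ereal (u x) - u' x) x y + end_gap (\<lambda>x. u' x - v' x) x y + end_gap (\<lambda>x. ereal (v x) - v' x) x y"
proof (cases "\<bar>u' x\<bar> = \<infinity> \<or> \<bar>u' y\<bar> = \<infinity> \<or> \<bar>v' x\<bar> = \<infinity> \<or> \<bar>v' y\<bar> = \<infinity>")
  case True
  then have "end_gap (\<lambda>x. ereal (u x) - u' x) x y = \<infinity> \<or> end_gap (\<lambda>x. ereal (v x) - v' x) x y = \<infinity>"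
    by (auto simp: end_gap_def)
  then show ?thesis by auto
next
  case False
  then obtain a b c d where [simp]: "u' x = ereal a" "u' y = ereal b" "v' x = ereal c" "v' y = ereal d"
    by (metis ereal_infinity_cases abs_ereal.simps(2,3) ereal_cases)
  show ?thesis
    by (simp add: end_gap_def e2ennreal_ereal flip: ennreal_plus)
qed

section \<open>The distance from the radial singularity to Lipschitz functions\<close>

lemma curve_integral_dilation_segment:
  fixes X :: "'a::euclidean_space set"
  assumes X: "X = ball 0 1 - {0}"
    and x: "x \<noteq> 0" "norm x < 1 / 2" and \<rho>: "\<rho> \<in> borel_measurable (restrict_space borel X)"
  shows "linepath x (2 *\<^sub>R x) \<in> rect_curves X"
    and "curve_integral (linepath x (2 *\<^sub>R x)) \<rho> = dilation_integral X \<rho> x"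
proof -
  have ne: "x \<noteq> 2 *\<^sub>R x" using x by (metis scaleR_one scaleR_right_imp_eq one_eq_numeral_iff num.distinct(1))
  have lp: "linepath x (2 *\<^sub>R x) t = (1 + t) *\<^sub>R x" for t
    by (simp add: linepath_def scaleR_2 algebra_simps del: scaleR_scaleR)
  have seg: "closed_segment x (2 *\<^sub>R x) \<subseteq> X"
  proof
    fix z assume "z \<in> closed_segment x (2 *\<^sub>R x)"
    then obtain t where t: "t \<in> {0..1}" "z = (1 + t) *\<^sub>R x"
      unfolding linepath_image_01[symmetric] lp by blast
    have "(1 + t) * norm x \<le> 2 * norm x" using t by (intro mult_right_mono) auto
    also have "\<dots> < 1" using x by simp
    finally show "z \<in> X" using t x by (simp add: X)
  qed
  show "linepath x (2 *\<^sub>R x) \<in> rect_curves X" by (rule linepath_rect_curves[OF ne seg])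
  have "dist x (2 *\<^sub>R x) = norm x"
    unfolding dist_norm by (simp add: scaleR_2)
  then show "curve_integral (linepath x (2 *\<^sub>R x)) \<rho> = dilation_integral X \<rho> x"
    using curve_integral_linepath[OF ne \<rho> _ seg] by (simp add: dilation_integral_def lp X)
qed

text \<open>
  With the level \<open>a = N * r powr - b\<close> both terms of the local \<open>L\<^sup>1\<close> bound scale like \<open>r powr (n - b)\<close>; the
  length of the segments contributes another factor \<open>r\<close>.
\<close>
lemma dilation_integral_weak_bound:
  fixes X :: "'a::euclidean_space set"
  assumes X: "X = ball 0 1 - {0}" and p: "1 < p" and b: "b = real DIM('a) / p"
    and \<rho>: "\<rho> \<in> borel_measurable (restrict_space borel X)"
    and norm: "weak_norm p (lebesgue_on X) (enn2ereal \<circ> \<rho>) \<le> ennreal N"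
    and N: "0 < N" and r: "0 < r"
  shows "(\<integral>\<^sup>+x\<in>ball 0 r. dilation_integral X \<rho> x \<partial>lborel) \<le>
    ennreal (N * (2 ^ DIM('a) * unit_ball_vol (real DIM('a)) + 1 / (p - 1)) * r powr (1 + real DIM('a) - b))"
proof -
  define n where "n = DIM('a)"
  define \<omega> where "\<omega> = unit_ball_vol (real DIM('a))"
  have \<omega>: "\<omega> \<ge> 0" unfolding \<omega>_def by simp
  have Xl: "X \<in> lmeasurable" unfolding X by (intro fmeasurable_Diff) auto
  have bp: "b * p = n" using b p by (simp add: n_def)
  define a where "a = N * r powr - b"
  have a: "a > 0" using N r by (simp add: a_def)
  have "emeasure (lebesgue_on X) (ball 0 (2 * r) \<inter> X) = emeasure lebesgue (ball 0 (2 * r) \<inter> X)"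
    using Xl by (subst emeasure_restrict_space) auto
  also have "\<dots> \<le> emeasure lebesgue (ball (0::'a) (2 * r))" by (rule emeasure_mono) auto
  also have "\<dots> = ennreal (\<omega> * (2 * r) ^ n)"
    using emeasure_ball[of "2 * r" "0::'a"] r by (simp add: emeasure_completion \<omega>_def n_def)
  finally have ball: "emeasure (lebesgue_on X) (ball 0 (2 * r) \<inter> X) \<le> ennreal (\<omega> * (2 * r) ^ n)" .
  have "(\<integral>\<^sup>+x\<in>ball 0 (2 * r). \<rho> x \<partial>lebesgue_on X) = (\<integral>\<^sup>+x\<in>ball 0 (2 * r) \<inter> X. \<rho> x \<partial>lebesgue_on X)"
    by (intro nn_integral_cong) (auto simp: space_restrict_space indicator_def)
  also have "\<dots> \<le> ennreal a * emeasure (lebesgue_on X) (ball 0 (2 * r) \<inter> X) + ennreal (N powr p * a powr (1 - p) / (p - 1))"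
    by (rule nn_integral_le_weak_norm[OF finite_measure_lebesgue_on[OF Xl] borel_measurable_lebesgue_onI[OF \<rho>] _ norm p a])
      (use N Xl in \<open>auto simp: sets_restrict_space\<close>)
  also have "\<dots> \<le> ennreal a * ennreal (\<omega> * (2 * r) ^ n) + ennreal (N powr p * a powr (1 - p) / (p - 1))"
    by (intro add_right_mono mult_left_mono ball) simp
  also have "ennreal a * ennreal (\<omega> * (2 * r) ^ n) = ennreal (N * (2 ^ n * \<omega>) * r powr (n - b))"
    using a r \<omega> by (simp add: a_def power_mult_distrib powr_diff powr_minus_divide powr_realpow mult_ac flip: ennreal_mult)
  also have "N powr p * a powr (1 - p) / (p - 1) = N * (1 / (p - 1)) * r powr (n - b)"
  proof -
    have "N powr p * a powr (1 - p) = N powr p * N powr (1 - p) * (r powr - b) powr (1 - p)"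
      using N r by (simp add: a_def powr_mult)
    also have "N powr p * N powr (1 - p) = N" using N by (simp flip: powr_add)
    also have "(r powr - b) powr (1 - p) = r powr (n - b)"
      unfolding powr_powr using bp by (simp add: algebra_simps)
    finally show ?thesis by simp
  qed
  also have "ennreal (N * (2 ^ n * \<omega>) * r powr (n - b)) + ennreal (N * (1 / (p - 1)) * r powr (n - b))
     = ennreal (N * (2 ^ n * \<omega> + 1 / (p - 1)) * r powr (n - b))"
    using N \<omega> p by (simp add: algebra_simps flip: ennreal_plus)
  finally have "(\<integral>\<^sup>+x\<in>ball 0 r. dilation_integral X \<rho> x \<partial>lborel) \<le>
    ennreal r * ennreal (N * (2 ^ n * \<omega> + 1 / (p - 1)) * r powr (n - b))"
    using X r by (intro order_trans[OF nn_integral_dilation_integral_le[OF \<rho>] mult_left_mono]) auto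
  also have "\<dots> = ennreal (N * (2 ^ n * \<omega> + 1 / (p - 1)) * r powr (1 + n - b))"
  proof -
    have "r * r powr (n - b) = r powr (1 + n - b)"
      using r by (simp add: powr_add powr_diff)
    moreover have "r * (C * r powr (n - b)) = C * (r * r powr (n - b))" for C
      by (simp only: mult_ac)
    ultimately show ?thesis by (simp only: ennreal_mult'[OF less_imp_le[OF r], symmetric])
  qed
  finally show ?thesis by (simp add: n_def \<omega>_def)
qed

text \<open>
  Below the scale \<open>r\<close>, where the singular derivative dominates the Lipschitz constant, the singular
  function minus \<open>f\<close> still oscillates along the segment. The assumption \<open>1 \<le> b\<close> makes the bound uniform
  over the ball of radius \<open>r\<close>.
\<close>
lemma radial_singularity_oscillation:
  fixes X :: "'a::euclidean_space set" and F :: "real \<Rightarrow> real"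
  assumes X: "X = ball 0 1 - {0}" and b1: "1 \<le> b"
    and F: "\<And>s. 0 < s \<Longrightarrow> (F has_real_derivative - (s powr - b)) (at s)"
    and L: "L-lipschitz_on X f" "L * 2 \<le> (2 * r) powr - b" and r: "0 < r" "r \<le> 1 / 2"
    and x: "x \<noteq> 0" "norm x < r"
  shows "2 powr - b / 2 * r powr (1 - b) \<le> (F (norm x) - F (norm (2 *\<^sub>R x))) - (f x - f (2 *\<^sub>R x))"
proof -
  define s where "s = norm x"
  have s: "0 < s" "s < r" using x by (auto simp: s_def)
  have "\<exists>z>s. z < 2 * s \<and> F (2 * s) - F s = (2 * s - s) * - (z powr - b)"
    by (rule MVT2) (use s F in auto)
  then obtain z where z: "s < z" "z < 2 * s" "F (2 * s) - F s = (2 * s - s) * - (z powr - b)" by blast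
  have "(2 * s) powr - b \<le> z powr - b" using z s b1 by (intro powr_mono2') auto
  then have "s * (2 * s) powr - b \<le> s * z powr - b" using s by (intro mult_left_mono) auto
  moreover have "F s - F (2 * s) = s * z powr - b" using z(3) by simp
  ultimately have F_diff: "s * (2 * s) powr - b \<le> F s - F (2 * s)" by linarith
  have "f x - f (2 *\<^sub>R x) \<le> dist (f x) (f (2 *\<^sub>R x))" by (simp add: dist_real_def)
  also have "\<dots> \<le> L * dist x (2 *\<^sub>R x)"
    by (rule lipschitz_onD[OF L(1)]) (use x r in \<open>auto simp: X\<close>)
  also have "dist x (2 *\<^sub>R x) = s" unfolding dist_norm s_def by (simp add: scaleR_2)
  finally have f_diff: "f x - f (2 *\<^sub>R x) \<le> s * L" by (simp add: mult.commute)
  have "L * 2 \<le> (2 * s) powr - b"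
    using L(2) powr_mono2'[of "- b" "2 * s" "2 * r"] s b1 by simp
  then have "s * L \<le> s * ((2 * s) powr - b / 2)" using s by (intro mult_left_mono) auto
  then have "s * (2 * s) powr - b / 2 \<le> (F s - F (2 * s)) - (f x - f (2 *\<^sub>R x))"
    using F_diff f_diff by simp
  moreover have "s * (2 * s) powr - b / 2 = 2 powr - b / 2 * s powr (1 - b)"
    using s by (simp add: powr_mult powr_diff powr_minus_divide)
  moreover have "2 powr - b / 2 * r powr (1 - b) \<le> 2 powr - b / 2 * s powr (1 - b)"
    using s b1 by (intro mult_left_mono powr_mono2') auto
  moreover have "norm (2 *\<^sub>R x) = 2 * s" by (simp add: s_def)
  ultimately show ?thesis by (simp only: s_def[symmetric])
qed

text \<open>
  Integrating the oscillation over the ball of radius \<open>r\<close> gives on one side a multiple of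
  \<open>r powr (1 + n - b)\<close> and on the other side \<open>\<epsilon>\<close> times another multiple of the same power. Hence the
  lower bound for \<open>\<epsilon>\<close> does not depend on \<open>r\<close>, and so not on the Lipschitz constant, although \<open>r\<close> does.
  The functions \<open>u'\<close> and \<open>v'\<close> stand for arbitrary representatives of two classes.
\<close>
lemma radial_singularity_not_near_lipschitz:
  fixes X :: "'a::euclidean_space set" and F :: "real \<Rightarrow> real"
  assumes X: "X = ball 0 1 - {0}" and p: "1 < p" and b: "b = real DIM('a) / p" and b1: "1 \<le> b"
    and F: "\<And>s. 0 < s \<Longrightarrow> (F has_real_derivative - (s powr - b)) (at s)"
    and f: "L-lipschitz_on X f" and \<epsilon>: "0 < \<epsilon>"
    and small: "24 * \<epsilon> * (2 ^ DIM('a) * unit_ball_vol (real DIM('a)) + 1 / (p - 1))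
                 \<le> 2 powr - b * unit_ball_vol (real DIM('a))"
    and norm1: "newtonian_norm p X (\<lambda>x. ereal (F (norm x)) - u' x) < ennreal \<epsilon>"
    and norm2: "newtonian_norm p X (\<lambda>x. u' x - v' x) < ennreal \<epsilon>"
    and norm3: "newtonian_norm p X (\<lambda>x. ereal (f x) - v' x) < ennreal \<epsilon>"
  shows False
proof -
  define n where "n = DIM('a)"
  define \<omega> where "\<omega> = unit_ball_vol (real DIM('a))"
  define K where "K = 2 ^ DIM('a) * unit_ball_vol (real DIM('a)) + 1 / (p - 1)"
  have \<omega>: "\<omega> > 0" unfolding \<omega>_def by simp
  have K: "K > 0" using p by (auto simp: K_def intro!: add_nonneg_pos)
  \<comment> \<open>The radius \<open>r\<close> is chosen such that \<open>(2 * r) powr - b = M\<close>.\<close>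
  define M where "M = max 1 (2 * L)"
  define r where "r = M powr - (1 / b) / 2"
  have M: "M \<ge> 1" "2 * L \<le> M" by (auto simp: M_def)
  have b0: "b > 0" using b1 by simp
  have "M powr - (1 / b) \<le> 1" using powr_mono2'[of "- (1 / b)" 1 M] M b0 by simp
  then have r: "0 < r" "r \<le> 1 / 2" using M by (auto simp: r_def)
  have "(2 * r) powr - b = M" using M b0 by (simp add: r_def powr_powr)
  then have Lr: "L * 2 \<le> (2 * r) powr - b" using M by simp
  define D where "D = 2 powr - b / 2 * r powr (1 - b)"
  have D: "D > 0" using r by (simp add: D_def)
  define R where "R = r powr (1 + real n - b)"
  have R: "R > 0" using r by (simp add: R_def)
  have p0: "0 < p" using p by simp
  have \<eta>: "0 < \<epsilon> / D" using D \<epsilon> by simp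
  obtain g1 \<rho>1 where 1: "g1 \<in> borel_measurable (restrict_space borel X)" "\<rho>1 \<in> borel_measurable (restrict_space borel X)"
    "weak_norm p (lebesgue_on X) (enn2ereal \<circ> g1) \<le> ennreal \<epsilon>"
    "weak_norm p (lebesgue_on X) (enn2ereal \<circ> \<rho>1) \<le> ennreal (\<epsilon> / D)"
    "\<forall>\<gamma>\<in>rect_curves X. 1 \<le> curve_integral \<gamma> \<rho>1 \<or>
       end_gap (\<lambda>x. ereal (F (norm x)) - u' x) (pathstart \<gamma>) (pathfinish \<gamma>) \<le> curve_integral \<gamma> g1"
    by (rule newtonian_norm_lessE[OF norm1 p0 \<epsilon> \<eta>])
  obtain g2 \<rho>2 where 2: "g2 \<in> borel_measurable (restrict_space borel X)" "\<rho>2 \<in> borel_measurable (restrict_space borel X)"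
    "weak_norm p (lebesgue_on X) (enn2ereal \<circ> g2) \<le> ennreal \<epsilon>"
    "weak_norm p (lebesgue_on X) (enn2ereal \<circ> \<rho>2) \<le> ennreal (\<epsilon> / D)"
    "\<forall>\<gamma>\<in>rect_curves X. 1 \<le> curve_integral \<gamma> \<rho>2 \<or>
       end_gap (\<lambda>x. u' x - v' x) (pathstart \<gamma>) (pathfinish \<gamma>) \<le> curve_integral \<gamma> g2"
    by (rule newtonian_norm_lessE[OF norm2 p0 \<epsilon> \<eta>])
  obtain g3 \<rho>3 where 3: "g3 \<in> borel_measurable (restrict_space borel X)" "\<rho>3 \<in> borel_measurable (restrict_space borel X)"
    "weak_norm p (lebesgue_on X) (enn2ereal \<circ> g3) \<le> ennreal \<epsilon>"
    "weak_norm p (lebesgue_on X) (enn2ereal \<circ> \<rho>3) \<le> ennreal (\<epsilon> / D)"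
    "\<forall>\<gamma>\<in>rect_curves X. 1 \<le> curve_integral \<gamma> \<rho>3 \<or>
       end_gap (\<lambda>x. ereal (f x) - v' x) (pathstart \<gamma>) (pathfinish \<gamma>) \<le> curve_integral \<gamma> g3"
    by (rule newtonian_norm_lessE[OF norm3 p0 \<epsilon> \<eta>])
  let ?J = "dilation_integral X"
  \<comment> \<open>The weight \<open>D\<close> lets an exceptional segment alone account for the whole lower bound.\<close>
  define T where "T = (\<lambda>g \<rho> x. ?J g x + ennreal D * ?J \<rho> x)"
  have XB: "X \<in> sets borel" by (simp add: X)
  have [measurable]: "ball (0::'a) r \<in> sets borel" by simp
  have pointwise: "ennreal D \<le> T g1 \<rho>1 x + T g2 \<rho>2 x + T g3 \<rho>3 x" if x: "x \<noteq> 0" "norm x < r" for x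
  proof -
    have x': "norm x < 1 / 2" using x r by simp
    note curve = curve_integral_dilation_segment[OF X x(1) x']
    let ?y = "2 *\<^sub>R x"
    let ?w1 = "\<lambda>x. ereal (F (norm x)) - u' x"
    let ?w2 = "\<lambda>x. u' x - v' x"
    let ?w3 = "\<lambda>x. ereal (f x) - v' x"
    have split: "ennreal D \<le> ennreal D * ?J \<rho> x \<or> end_gap w x ?y \<le> ?J g x"
      if "1 \<le> ?J \<rho> x \<or> end_gap w x ?y \<le> ?J g x" for \<rho> w g
      using that mult_left_mono[of 1 "?J \<rho> x" "ennreal D"] by auto
    have "1 \<le> ?J \<rho>1 x \<or> end_gap ?w1 x ?y \<le> ?J g1 x"
      using bspec[OF 1(5) curve(1)[OF 1(1)]] by (simp add: curve(2) 1(1,2))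
    from split[OF this] have s1: "ennreal D \<le> T g1 \<rho>1 x \<or> end_gap ?w1 x ?y \<le> T g1 \<rho>1 x"
      unfolding T_def by (auto intro: add_increasing add_increasing2)
    have "1 \<le> ?J \<rho>2 x \<or> end_gap ?w2 x ?y \<le> ?J g2 x"
      using bspec[OF 2(5) curve(1)[OF 1(1)]] by (simp add: curve(2) 2(1,2))
    from split[OF this] have s2: "ennreal D \<le> T g2 \<rho>2 x \<or> end_gap ?w2 x ?y \<le> T g2 \<rho>2 x"
      unfolding T_def by (auto intro: add_increasing add_increasing2)
    have "1 \<le> ?J \<rho>3 x \<or> end_gap ?w3 x ?y \<le> ?J g3 x"
      using bspec[OF 3(5) curve(1)[OF 1(1)]] by (simp add: curve(2) 3(1,2))
    from split[OF this] have s3: "ennreal D \<le> T g3 \<rho>3 x \<or> end_gap ?w3 x ?y \<le> T g3 \<rho>3 x"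
      unfolding T_def by (auto intro: add_increasing add_increasing2)
    have "D \<le> (F (norm x) - F (norm ?y)) - (f x - f ?y)"
      unfolding D_def by (rule radial_singularity_oscillation[OF X b1 F f Lr r x])
    then have "ennreal D \<le> ennreal \<bar>(F (norm x) - F (norm ?y)) - (f x - f ?y)\<bar>"
      by (intro ennreal_leI) linarith
    also have "\<dots> \<le> end_gap ?w1 x ?y + end_gap ?w2 x ?y + end_gap ?w3 x ?y"
      by (rule end_gap_triangle)
    finally have all: "ennreal D \<le> end_gap ?w1 x ?y + end_gap ?w2 x ?y + end_gap ?w3 x ?y" .
    consider "ennreal D \<le> T g1 \<rho>1 x" | "ennreal D \<le> T g2 \<rho>2 x" | "ennreal D \<le> T g3 \<rho>3 x"
      | "end_gap ?w1 x ?y \<le> T g1 \<rho>1 x" "end_gap ?w2 x ?y \<le> T g2 \<rho>2 x" "end_gap ?w3 x ?y \<le> T g3 \<rho>3 x"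
      using s1 s2 s3 by blast
    then show ?thesis
    proof cases
      case 4
      have "ennreal D \<le> end_gap ?w1 x ?y + end_gap ?w2 x ?y + end_gap ?w3 x ?y" by (rule all)
      also have "\<dots> \<le> T g1 \<rho>1 x + T g2 \<rho>2 x + T g3 \<rho>3 x" by (intro add_mono 4)
      finally show ?thesis .
    next
      case 1
      show ?thesis by (rule add_increasing2[OF _ add_increasing2[OF _ 1]]) auto
    next
      case 2
      show ?thesis by (rule add_increasing2[OF _ add_increasing[OF _ 2]]) auto
    next
      case 3
      show ?thesis by (rule add_increasing[OF _ 3]) auto
    qed
  qed
  have Tm: "T g \<rho> \<in> borel_measurable borel"
    if "g \<in> borel_measurable (restrict_space borel X)" "\<rho> \<in> borel_measurable (restrict_space borel X)" for g \<rho>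
    using borel_measurable_dilation_integral[OF that(1) XB] borel_measurable_dilation_integral[OF that(2) XB]
    unfolding T_def by measurable
  have Tint: "(\<integral>\<^sup>+x\<in>ball 0 r. T g \<rho> x \<partial>lborel) \<le> ennreal (2 * (\<epsilon> * K * R))"
    if g: "g \<in> borel_measurable (restrict_space borel X)" and \<rho>: "\<rho> \<in> borel_measurable (restrict_space borel X)"
      and gN: "weak_norm p (lebesgue_on X) (enn2ereal \<circ> g) \<le> ennreal \<epsilon>"
      and \<rho>N: "weak_norm p (lebesgue_on X) (enn2ereal \<circ> \<rho>) \<le> ennreal (\<epsilon> / D)" for g \<rho>
  proof -
    have [measurable]: "?J g \<in> borel_measurable borel" "?J \<rho> \<in> borel_measurable borel"
      by (rule borel_measurable_dilation_integral[OF g XB], rule borel_measurable_dilation_integral[OF \<rho> XB])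
    have "(\<integral>\<^sup>+x\<in>ball 0 r. T g \<rho> x \<partial>lborel) =
      (\<integral>\<^sup>+x. ?J g x * indicator (ball 0 r) x + ennreal D * (?J \<rho> x * indicator (ball 0 r) x) \<partial>lborel)"
      by (intro nn_integral_cong) (simp add: T_def indicator_def)
    also have "\<dots> = (\<integral>\<^sup>+x\<in>ball 0 r. ?J g x \<partial>lborel) + ennreal D * (\<integral>\<^sup>+x\<in>ball 0 r. ?J \<rho> x \<partial>lborel)"
      by (subst nn_integral_add) (auto intro!: nn_integral_cmult)
    also have "\<dots> \<le> ennreal (\<epsilon> * K * R) + ennreal D * ennreal (\<epsilon> / D * K * R)"
      using dilation_integral_weak_bound[OF X p b g gN \<epsilon> r(1)] dilation_integral_weak_bound[OF X p b \<rho> \<rho>N \<eta> r(1)]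
      by (intro add_mono mult_left_mono) (auto simp: K_def R_def n_def)
    also have "\<dots> = ennreal (2 * (\<epsilon> * K * R))"
      using D \<epsilon> K R by (simp flip: ennreal_mult ennreal_plus)
    finally show ?thesis .
  qed
  note [measurable] = Tm[OF 1(1,2)] Tm[OF 2(1,2)] Tm[OF 3(1,2)]
  have "ennreal (D * (\<omega> * r ^ n)) = (\<integral>\<^sup>+x\<in>ball (0::'a) r. ennreal D \<partial>lborel)"
    using emeasure_ball[of r "0::'a"] r D \<omega>
    by (simp add: nn_integral_cmult_indicator \<omega>_def n_def flip: ennreal_mult)
  also have "\<dots> \<le> (\<integral>\<^sup>+x. T g1 \<rho>1 x * indicator (ball 0 r) x + T g2 \<rho>2 x * indicator (ball 0 r) x
      + T g3 \<rho>3 x * indicator (ball 0 r) x \<partial>lborel)"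
    by (rule nn_integral_mono_AE, rule AE_mp[OF AE_lborel_singleton[of 0]])
      (auto intro!: AE_I2 simp: indicator_def pointwise)
  also have "\<dots> = (\<integral>\<^sup>+x\<in>ball 0 r. T g1 \<rho>1 x \<partial>lborel) + (\<integral>\<^sup>+x\<in>ball 0 r. T g2 \<rho>2 x \<partial>lborel)
      + (\<integral>\<^sup>+x\<in>ball 0 r. T g3 \<rho>3 x \<partial>lborel)"
    by (simp add: nn_integral_add)
  also have "\<dots> \<le> ennreal (2 * (\<epsilon> * K * R)) + ennreal (2 * (\<epsilon> * K * R)) + ennreal (2 * (\<epsilon> * K * R))"
    by (intro add_mono Tint 1 2 3)
  also have "\<dots> = ennreal (6 * \<epsilon> * K * R)"
    using \<epsilon> K R by (simp flip: ennreal_plus)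
  finally have "D * (\<omega> * r ^ n) \<le> 6 * \<epsilon> * K * R"
    using \<epsilon> K R by (simp add: ennreal_le_iff)
  moreover have "r powr (1 - b) * r ^ n = R"
    using r by (simp add: R_def algebra_simps powr_realpow[symmetric] flip: powr_add)
  then have "D * (\<omega> * r ^ n) = 2 powr - b * \<omega> / 2 * R" by (simp add: D_def mult_ac)
  ultimately have "2 powr - b * \<omega> / 2 * R \<le> 6 * \<epsilon> * K * R" by simp
  then have "2 powr - b * \<omega> / 2 \<le> 6 * \<epsilon> * K" using R by (simp only: mult_le_cancel_right_pos)
  moreover have "24 * \<epsilon> * K \<le> 2 powr - b * \<omega>" using small by (simp add: K_def \<omega>_def)
  moreover have "2 powr - b * \<omega> > 0" using \<omega> by simp
  ultimately show False by linarith
qed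

theorem mainTheorem6:
  fixes p :: real and X :: "(real ^ 'n) set"
  assumes "CARD('n) \<ge> 2"
    and "1 < p" and "p \<le> real CARD('n)"
    and "X = ball 0 1 - {0}"
  shows "\<exists>U \<in> newtonian p X.
           \<not> (\<exists>f :: nat \<Rightarrow> real ^ 'n \<Rightarrow> real.
                (\<forall>k. (\<exists>L. L-lipschitz_on X (f k)) \<and> (\<lambda>x. ereal (f k x)) \<in> pre_newtonian p X) \<and>
                (\<lambda>k. newtonian_dist p X U (newtonian_class p X (\<lambda>x. ereal (f k x)))) \<longlonglongrightarrow> 0)"
proof -
  note p = assms(2) and X = assms(4)
  define b where "b = real DIM(real ^ 'n) / p"
  have b: "b = real DIM(real ^ 'n) / p" by (fact b_def)
  have b1: "1 \<le> b" using assms by (simp add: b_def)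
  obtain F :: "real \<Rightarrow> real" where F': "\<forall>s>0. (F has_real_derivative - (s powr - b)) (at s)" and F1: "F 1 = 0"
    by (rule ex_powr_antiderivative[of b])
  then have F: "\<And>s. 0 < s \<Longrightarrow> (F has_real_derivative - (s powr - b)) (at s)" by blast
  define u where "u = (\<lambda>x::real ^ 'n. ereal (F (norm x)))"
  define \<omega> where "\<omega> = unit_ball_vol (real DIM(real ^ 'n))"
  define K where "K = 2 ^ DIM(real ^ 'n) * \<omega> + 1 / (p - 1)"
  define \<epsilon> where "\<epsilon> = 2 powr - b * \<omega> / (24 * K)"
  have \<omega>: "\<omega> > 0" by (simp add: \<omega>_def)
  then have K: "K > 0" using p by (auto simp: K_def intro!: add_nonneg_pos)
  have \<epsilon>: "0 < \<epsilon>" "24 * \<epsilon> * K \<le> 2 powr - b * \<omega>" using \<omega> K by (auto simp: \<epsilon>_def)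
  show ?thesis
  proof (rule bexI[of _ "newtonian_class p X u"], safe)
    have "u \<in> pre_newtonian p X"
      unfolding u_def by (rule radial_singularity_in_pre_newtonian[OF X p b F F1])
    then show "newtonian_class p X u \<in> newtonian p X"
      unfolding newtonian_def newtonian_class_def by (rule quotientI)
  next
    fix f :: "nat \<Rightarrow> real ^ 'n \<Rightarrow> real"
    assume f: "\<forall>k. (\<exists>L. L-lipschitz_on X (f k)) \<and> (\<lambda>x. ereal (f k x)) \<in> pre_newtonian p X"
      and lim: "(\<lambda>k. newtonian_dist p X (newtonian_class p X u) (newtonian_class p X (\<lambda>x. ereal (f k x)))) \<longlonglongrightarrow> 0"
    have "eventually (\<lambda>k. newtonian_dist p X (newtonian_class p X u) (newtonian_class p X (\<lambda>x. ereal (f k x))) < ennreal \<epsilon>) sequentially"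
      by (rule order_tendstoD(2)[OF lim]) (use \<epsilon> in simp)
    then obtain k where "newtonian_dist p X (newtonian_class p X u) (newtonian_class p X (\<lambda>x. ereal (f k x))) < ennreal \<epsilon>"
      by (auto simp: eventually_sequentially)
    then obtain u' v' where "u' \<in> newtonian_class p X u" "v' \<in> newtonian_class p X (\<lambda>x. ereal (f k x))"
      and *: "newtonian_norm p X (\<lambda>x. u' x - v' x) < ennreal \<epsilon>"
      unfolding newtonian_dist_def INF_less_iff by blast
    then have "newtonian_norm p X (\<lambda>x. u x - u' x) < ennreal \<epsilon>"
      "newtonian_norm p X (\<lambda>x. ereal (f k x) - v' x) < ennreal \<epsilon>"
      using \<epsilon> by (auto simp: newtonian_class_def newtonian_rel_def)
    moreover obtain L where "L-lipschitz_on X (f k)" using f by blast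
    ultimately show False
      using radial_singularity_not_near_lipschitz[OF X p b b1 F _ \<epsilon>(1) \<epsilon>(2)[unfolded K_def \<omega>_def] _ *, of L "f k"]
      by (simp add: u_def)
  qed
qed

end
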